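(* Let $\dim V=(n|m)$ and $h\ge0$ an integer. The element $$\sum_L(-1)^{\alpha(L,L)}\,e_s\big(v_{I_h}\otimes v_L\big)\otimes\tilde e_t\big(v^*_L\otimes v^*_{J_h}\big)\in V^{\otimes n(m+h)}\otimes V^{*\otimes m(n+h)}=T^{n(m+h),m(n+h)}(V),$$ where $L$ runs over all sequences of length $nm$ with entries in $R_V$, is $\mathfrak{sl}(V)$-invariant. (This is the element $e_s\times\tilde e_t(v_{I_h}\otimes\theta_{nm}\otimes v^*_{J_h})$.)
   Context: $V$ has homogeneous basis $e_i$, $i\in R_V=\{1,\dots,n,\bar1,\dots,\bar m\}$ (barred indices odd), $e_i^*$ the left dual basis; $v_I=e_{i_1}\otimes\dots\otimes e_{i_N}$, $v^*_I=e^*_{i_1}\otimes\dots\otimes e^*_{i_N}$; $\alpha(L,L)=\sum_{i<j}p(l_i)p(l_j)$. $\mathfrak S_N$ acts on $X^{\otimes N}$ ($X=V,V^*$) by $\sigma v_I=c(I,\sigma^{-1})v_{\sigma I}$, with $c(I,\sigma)=\pm1$ defined by $x_{\sigma^{-1}I}=c(I,\sigma)x_I$ in the free supercommutative algebra on generators $x_i$ of parity $p(i)$. $e_t=\sum_{\tau\in C_t,\sigma\in R_t}\varepsilon(\tau)\sigma\tau$, $\tilde e_t=\sum_{\tau\in C_t,\sigma\in R_t}\varepsilon(\tau)\tau\sigma$. $t$: rectangular tableau with $n+h$ rows and $m$ columns, first $n$ rows filled with $1,\dots,nm$ column by column, last $h$ rows with $nm+1,\dots,nm+hm$ column by column. $s$: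 tableau with $n$ rows and $h+m$ columns, first $h$ columns filled with $1,\dots,hn$ column by column, last $m$ columns with $hn+1,\dots,hn+mn$ column by column. $I_h$: the sequence $1,\dots,n$ repeated $h$ times; $J_h$: $h$ copies of $\bar1$, then $h$ copies of $\bar2$, ..., $h$ copies of $\bar m$. $e_s$ acts on the $V$-factors, $\tilde e_t$ on the $V^*$-factors. *)

theory Defs
  imports "HOL-Combinatorics.Permutations"
begin

datatype idx = Ev nat | Od nat

fun par :: "idx \<Rightarrow> nat" where
  "par (Ev _) = 0"
| "par (Od _) = 1"

definition RV :: "nat \<Rightarrow> nat \<Rightarrow> idx set" where
  "RV n m = Ev ` {1..n} \<union> Od ` {1..m}"

definition psum :: "idx list \<Rightarrow> nat" where
  "psum L = sum_list (map par L)"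

definition seqs :: "nat \<Rightarrow> nat \<Rightarrow> nat \<Rightarrow> idx list set" where
  "seqs n m N = {L. length L = N \<and> set L \<subseteq> RV n m}"

definition alpha :: "idx list \<Rightarrow> nat" where
  "alpha L = (\<Sum>j<length L. \<Sum>i<j. par (L!i) * par (L!j))"

section \<open>Tensors: coefficient functions w.r.t. the bases v_I, resp. v_I (x) v*_K\<close>

definition basis_v :: "idx list \<Rightarrow> idx list \<Rightarrow> 'a::field" where
  "basis_v K = (\<lambda>J. if J = K then 1 else 0)"

text \<open>c(I,sigma): sign with x_{sigma^{-1} I} = c(I,sigma) x_I in the free supercommutative
  algebra; explicitly the Koszul sign (-1)^(number of pairs of odd letters of I whose order
  is reversed), where letter a of I sits at position inv sigma a of sigma^{-1} I.\<close>
definition csign :: "idx list \<Rightarrow> (nat \<Rightarrow> nat) \<Rightarrow> 'a::field" where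
  "csign I \<sigma> = (-1) ^ card {(a,b). a < b \<and> b < length I \<and> par (I!a) = 1 \<and> par (I!b) = 1
                                 \<and> inv \<sigma> a > inv \<sigma> b}"

text \<open>sigma v_I = c(I,sigma^{-1}) v_{sigma I}, where (sigma I) has entry i_a at position sigma a.
  On coefficient functions: coefficient of v_J in sigma X.\<close>
definition permact :: "(nat \<Rightarrow> nat) \<Rightarrow> (idx list \<Rightarrow> 'a::field) \<Rightarrow> idx list \<Rightarrow> 'a" where
  "permact \<sigma> X J = (let I = map (\<lambda>a. J ! \<sigma> a) [0..<length J]
                      in csign I (inv \<sigma>) * X I)"

text \<open>A tableau with r rows and c columns is a map (row, column) to entries in {0..<r*c}.\<close>
definition rowgrp :: "(nat \<Rightarrow> nat \<Rightarrow> nat) \<Rightarrow> nat \<Rightarrow> nat \<Rightarrow> (nat \<Rightarrow> nat) set" where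
  "rowgrp T r c = {\<sigma>. \<sigma> permutes {0..<r*c} \<and>
      (\<forall>i<r. \<sigma> ` {T i j | j. j < c} = {T i j | j. j < c})}"

definition colgrp :: "(nat \<Rightarrow> nat \<Rightarrow> nat) \<Rightarrow> nat \<Rightarrow> nat \<Rightarrow> (nat \<Rightarrow> nat) set" where
  "colgrp T r c = {\<tau>. \<tau> permutes {0..<r*c} \<and>
      (\<forall>j<c. \<tau> ` {T i j | i. i < r} = {T i j | i. i < r})}"

definition young_e :: "(nat \<Rightarrow> nat \<Rightarrow> nat) \<Rightarrow> nat \<Rightarrow> nat \<Rightarrow> (idx list \<Rightarrow> 'a::field) \<Rightarrow> idx list \<Rightarrow> 'a" where
  "young_e T r c X J = (\<Sum>\<tau>\<in>colgrp T r c. \<Sum>\<sigma>\<in>rowgrp T r c.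
       of_int (sign \<tau>) * permact \<sigma> (permact \<tau> X) J)"

definition young_e' :: "(nat \<Rightarrow> nat \<Rightarrow> nat) \<Rightarrow> nat \<Rightarrow> nat \<Rightarrow> (idx list \<Rightarrow> 'a::field) \<Rightarrow> idx list \<Rightarrow> 'a" where
  "young_e' T r c X J = (\<Sum>\<tau>\<in>colgrp T r c. \<Sum>\<sigma>\<in>rowgrp T r c.
       of_int (sign \<tau>) * permact \<tau> (permact \<sigma> X) J)"

text \<open>t: n+h rows, m columns (0-based entries); s: n rows, h+m columns.\<close>
definition tab_t :: "nat \<Rightarrow> nat \<Rightarrow> nat \<Rightarrow> nat \<Rightarrow> nat \<Rightarrow> nat" where
  "tab_t n m h i j = (if i < n then j * n + i else n * m + j * h + (i - n))"

definition tab_s :: "nat \<Rightarrow> nat \<Rightarrow> nat \<Rightarrow> nat \<Rightarrow> nat \<Rightarrow> nat" where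
  "tab_s n m h i j = (if j < h then j * n + i else h * n + (j - h) * n + i)"

definition I_h :: "nat \<Rightarrow> nat \<Rightarrow> idx list" where
  "I_h n h = concat (replicate h (map Ev [1..<n+1]))"

definition J_h :: "nat \<Rightarrow> nat \<Rightarrow> idx list" where
  "J_h m h = concat (map (\<lambda>j. replicate h (Od j)) [1..<m+1])"

definition the_element :: "nat \<Rightarrow> nat \<Rightarrow> nat \<Rightarrow> idx list \<Rightarrow> idx list \<Rightarrow> 'a::field" where
  "the_element n m h I K = (\<Sum>L\<in>seqs n m (n*m).
      (-1) ^ alpha L
      * young_e (tab_s n m h) n (h+m) (basis_v (I_h n h @ L)) I
      * young_e' (tab_t n m h) (n+h) m (basis_v (L @ J_h m h)) K)"

text \<open>E_ab e_c = delta_bc e_a;  (X f)(v) = -(-1)^{p(X)p(f)} f(X v) with e*_i(e_j) = delta_ij,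
  giving E_ab e*_c = -(-1)^{(p(a)+p(b)) p(a)} delta_ca e*_b; extended to tensors by the
  super Leibniz rule.  gl_basis a b I K = E_ab (v_I (x) v*_K) as coefficient function.\<close>
definition gl_basis :: "idx \<Rightarrow> idx \<Rightarrow> idx list \<Rightarrow> idx list \<Rightarrow> idx list \<Rightarrow> idx list \<Rightarrow> 'a::field" where
  "gl_basis a b I K I' K' =
     (\<Sum>k<length I. if I!k = b \<and> I' = I[k := a] \<and> K' = K
        then (-1) ^ ((par a + par b) * psum (take k I)) else 0)
   + (\<Sum>k<length K. if K!k = a \<and> I' = I \<and> K' = K[k := b]
        then - ((-1) ^ ((par a + par b) * par a)
                * (-1) ^ ((par a + par b) * (psum I + psum (take k K)))) else 0)"

definition gl_act :: "nat \<Rightarrow> nat \<Rightarrow> nat \<Rightarrow> nat \<Rightarrow> (idx \<Rightarrow> idx \<Rightarrow> 'a::field)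
    \<Rightarrow> (idx list \<Rightarrow> idx list \<Rightarrow> 'a) \<Rightarrow> idx list \<Rightarrow> idx list \<Rightarrow> 'a" where
  "gl_act n m p q A X I' K' =
     (\<Sum>I\<in>seqs n m p. \<Sum>K\<in>seqs n m q. X I K *
        (\<Sum>a\<in>RV n m. \<Sum>b\<in>RV n m. A a b * gl_basis a b I K I' K'))"

definition supertrace :: "nat \<Rightarrow> nat \<Rightarrow> (idx \<Rightarrow> idx \<Rightarrow> 'a::field) \<Rightarrow> 'a" where
  "supertrace n m A = (\<Sum>i\<in>{1..n}. A (Ev i) (Ev i)) - (\<Sum>j\<in>{1..m}. A (Od j) (Od j))"

definition sl_invariant :: "nat \<Rightarrow> nat \<Rightarrow> nat \<Rightarrow> nat \<Rightarrow> (idx list \<Rightarrow> idx list \<Rightarrow> 'a::field) \<Rightarrow> bool" where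
  "sl_invariant n m p q X \<longleftrightarrow>
     (\<forall>A. supertrace n m A = 0 \<longrightarrow> gl_act n m p q A X = (\<lambda>_ _. 0))"

end

theory Submission
  imports Defs
begin

text \<open>
  Let \<open>X\<close> be the element. The Young symmetrizers commute with \<open>gl(V)\<close> and \<open>\<theta>\<close> is invariant, so the
  generators \<open>E\<^sub>a\<^sub>b\<close> only act on the outer factors \<open>v\<^bsub>I\<^sub>h\<^esub>\<close> and \<open>v\<^sup>*\<^bsub>J\<^sub>h\<^esub>\<close>. An even off-diagonal generator
  creates two equal even letters in a column of \<open>s\<close> or two equal odd letters in a row of \<open>t\<close>, hence
  kills \<open>X\<close>; a diagonal one multiplies \<open>X\<close> by \<open>h\<close> or \<open>-h\<close>, so that the diagonal acts through the
  supertrace; and \<open>E\<^sub>a\<^sub>b\<close> with \<open>a\<close> even and \<open>b\<close> odd kills both outer factors.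

  For \<open>a = Od j\<close>, \<open>b = Ev i\<close> put \<open>Y = E\<^sub>a\<^sub>b X\<close>. By the commutation relations \<open>Y\<close> is killed by all
  \<open>E\<^sub>a\<^sub>b\<close> with \<open>a\<close> even and \<open>b\<close> odd, it is symmetric in the rows of \<open>s\<close> and antisymmetric in the columns
  of \<open>t\<close>. The coefficients of \<open>Y\<close> at \<open>v\<^sub>I \<otimes> v\<^sup>*\<^sub>K\<close> with \<open>I\<close> purely even vanish, since then \<open>K\<close> has
  \<open>nm + 1\<close> even letters in \<open>m\<close> columns, so some column repeats one of the \<open>n\<close> even letters. The other
  coefficients vanish by induction on the number of odd letters of \<open>I\<close>, using the lowering relations.
\<close>

section \<open>Koszul signs\<close>

definition odds :: "idx list \<Rightarrow> nat set" where
  "odds J = {a. a < length J \<and> par (J ! a) = 1}"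

definition pairsign :: "(nat \<Rightarrow> nat) \<Rightarrow> nat \<Rightarrow> nat \<Rightarrow> 'a::field" where
  "pairsign f a b = (if (a < b) = (f a < f b) then 1 else -1)"

text \<open>For \<open>S\<close> the set of odd positions, this is \<open>csign\<close> written as a
  product instead of a power of -1. Products over pairs split well when a position is inserted or
  when two maps are composed.\<close>

definition koszul :: "nat set \<Rightarrow> (nat \<Rightarrow> nat) \<Rightarrow> 'a::field" where
  "koszul S f = (\<Prod>(a, b)\<in>{(a, b). a \<in> S \<and> b \<in> S \<and> a < b}. pairsign f a b)"

lemma finite_odds [simp]: "finite (odds J)"
  by (simp add: odds_def)

lemma par_cases: "par a = 0 \<or> par a = 1"
  by (cases a) auto

lemma pairsign_commute:
  assumes "a \<noteq> b" "f a \<noteq> f b"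
  shows "pairsign f a b = pairsign f b a"
  using assms by (auto simp: pairsign_def)

lemma koszul_empty [simp]: "koszul {} f = 1"
  by (simp add: koszul_def)

text \<open>The new pairs are those containing \<open>k\<close>. Injectivity makes
  \<open>pairsign\<close> symmetric in its two positions, so positions on either side of
  \<open>k\<close> contribute in the same form.\<close>

lemma koszul_insert:
  assumes "finite S" "k \<notin> S" "inj_on f (insert k S)"
  shows "(koszul (insert k S) f :: 'a::field) = koszul S f * (\<Prod>a\<in>S. pairsign f a k)"
proof -
  let ?A = "{(a, b). a \<in> S \<and> b \<in> S \<and> a < b}"
  let ?B = "(\<lambda>a. (a, k)) ` {a\<in>S. a < k}" and ?C = "(\<lambda>a. (k, a)) ` {a\<in>S. \<not> a < k}"
  have eq: "{(a, b). a \<in> insert k S \<and> b \<in> insert k S \<and> a < b} = ?A \<union> (?B \<union> ?C)"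
    using assms(2) by (auto simp: image_iff) (metis linorder_neqE_nat)
  have fin: "finite ?A" by (rule finite_subset[of _ "S \<times> S"]) (use assms in auto)
  have "(koszul (insert k S) f :: 'a) = koszul S f * (\<Prod>(a, b)\<in>?B \<union> ?C. pairsign f a b)"
    unfolding koszul_def eq
    by (rule prod.union_disjoint) (use assms fin in auto)
  also have "(\<Prod>(a, b)\<in>?B \<union> ?C. pairsign f a b)
      = (\<Prod>(a, b)\<in>?B. pairsign f a b) * (\<Prod>(a, b)\<in>?C. pairsign f a b :: 'a)"
    by (rule prod.union_disjoint) (use assms in auto)
  also have "(\<Prod>(a, b)\<in>?B. pairsign f a b) = (\<Prod>a\<in>{a\<in>S. a < k}. pairsign f a k :: 'a)"
    by (subst prod.reindex) (auto simp: inj_on_def)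
  also have "(\<Prod>(a, b)\<in>?C. pairsign f a b) = (\<Prod>a\<in>{a\<in>S. \<not> a < k}. pairsign f k a :: 'a)"
    by (subst prod.reindex) (auto simp: inj_on_def)
  also have "\<dots> = (\<Prod>a\<in>{a\<in>S. \<not> a < k}. pairsign f a k)"
    by (rule prod.cong[OF refl], rule pairsign_commute) (use assms in \<open>auto simp: inj_on_def\<close>)
  also have "(\<Prod>a\<in>{a\<in>S. a < k}. pairsign f a k) * (\<Prod>a\<in>{a\<in>S. \<not> a < k}. pairsign f a k)
      = (\<Prod>a\<in>S. pairsign f a k :: 'a)"
    by (subst prod.union_disjoint[symmetric]) (use assms in \<open>auto intro!: prod.cong\<close>)
  finally show ?thesis .
qed

text \<open>The cocycle identity behind the action of the symmetric group: a pair is reversed by the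
  composite exactly when one and only one of the two maps reverses it. The induction adds one
  position at a time.\<close>

lemma koszul_comp:
  assumes "finite S" "inj_on f S" "inj_on g (f ` S)"
  shows "(koszul S (g \<circ> f) :: 'a::field) = koszul (f ` S) g * koszul S f"
  using assms
proof (induction S)
  case (insert k S)
  have fk: "f k \<notin> f ` S" using insert by auto
  have inj: "inj_on f S" "inj_on g (f ` S)" using insert by auto
  have gf: "inj_on (g \<circ> f) (insert k S)" by (rule comp_inj_on) (use insert in auto)
  have "(koszul (insert k S) (g \<circ> f) :: 'a) = koszul S (g \<circ> f) * (\<Prod>a\<in>S. pairsign (g \<circ> f) a k)"
    by (rule koszul_insert) (use insert gf in auto)
  also have "(\<Prod>a\<in>S. pairsign (g \<circ> f) a k) = (\<Prod>a\<in>S. pairsign g (f a) (f k) * pairsign f a k :: 'a)"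
    by (rule prod.cong) (auto simp: pairsign_def)
  also have "\<dots> = (\<Prod>u\<in>f ` S. pairsign g u (f k)) * (\<Prod>a\<in>S. pairsign f a k)"
    using inj by (simp add: prod.distrib prod.reindex)
  also have "koszul S (g \<circ> f) * \<dots>
      = (koszul (f ` S) g * (\<Prod>u\<in>f ` S. pairsign g u (f k))) * (koszul S f * (\<Prod>a\<in>S. pairsign f a k))"
    unfolding insert.IH[OF inj] by (simp only: mult_ac)
  also have "\<dots> = koszul (f ` insert k S) g * koszul (insert k S) f"
    using insert fk by (simp add: koszul_insert)
  finally show ?case .
qed auto

lemma koszul_fixed:
  assumes "\<And>a. a \<in> S \<Longrightarrow> f a = a"
  shows "koszul S f = 1"
  unfolding koszul_def by (rule prod.neutral) (use assms in \<open>auto simp: pairsign_def\<close>)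

text \<open>The product over the odd positions \<open>a\<close> is the sign of moving an odd
  operator past the first \<open>k\<close> letters (\<open>sign_power_psum\<close>). With
  \<open>pairsign_before\<close>, the signs of operators and of permutations are written in the same
  terms.\<close>

definition before :: "nat \<Rightarrow> nat \<Rightarrow> 'a::field" where
  "before k a = (if a < k then -1 else 1)"

lemma pairsign_before: "pairsign f a k = before k a * before (f k) (f a)"
  by (auto simp: pairsign_def before_def)

text \<open>One odd letter moves between the positions \<open>x\<close> and \<open>y\<close>; each
  factor is -1 exactly for the odd positions lying between them.\<close>

lemma koszul_transpose_one:
  assumes "finite S" "x \<notin> S" "y \<notin> S"
  shows "koszul (insert y S) (transpose x y) = (\<Prod>a\<in>S. before y a * before x a)"
proof -
  have "koszul (insert y S) (transpose x y)
      = koszul S (transpose x y) * (\<Prod>a\<in>S. pairsign (transpose x y) a y)"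
    by (rule koszul_insert) (use assms in \<open>auto intro: inj_on_subset[OF inj_on_transpose]\<close>)
  also have "koszul S (transpose x y) = 1"
    by (rule koszul_fixed) (use assms in \<open>auto simp: transpose_def\<close>)
  also have "(\<Prod>a\<in>S. pairsign (transpose x y) a y) = (\<Prod>a\<in>S. before y a * before x a)"
    by (rule prod.cong) (use assms in \<open>auto simp: pairsign_before transpose_def\<close>)
  finally show ?thesis by simp
qed

text \<open>Each odd letter in between is passed twice, which cancels; what remains is the exchange
  of the two odd letters themselves.\<close>

lemma koszul_transpose_both:
  assumes "finite S" "x \<in> S" "y \<in> S" "x \<noteq> y"
  shows "(koszul S (transpose x y) :: 'a::field) = -1"
proof -
  define U where "U = S - {x, y}"
  have S: "S = insert x (insert y U)" and U: "finite U" "x \<notin> U" "y \<notin> U"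
    using assms by (auto simp: U_def)
  have "(koszul S (transpose x y) :: 'a) = koszul (insert y U) (transpose x y)
      * (\<Prod>a\<in>insert y U. pairsign (transpose x y) a x)"
    unfolding S by (rule koszul_insert) (use assms U in \<open>auto intro: inj_on_subset[OF inj_on_transpose]\<close>)
  also have "(\<Prod>a\<in>insert y U. pairsign (transpose x y) a x)
      = - (\<Prod>a\<in>U. pairsign (transpose x y) a x :: 'a)"
    using assms U by (auto simp: pairsign_def)
  also have "(\<Prod>a\<in>U. pairsign (transpose x y) a x) = (\<Prod>a\<in>U. before y a * before x a :: 'a)"
    by (rule prod.cong) (use U in \<open>auto simp: pairsign_before transpose_def\<close>)
  also have "koszul (insert y U) (transpose x y) = (\<Prod>a\<in>U. before y a * before x a :: 'a)"
    by (rule koszul_transpose_one) (use U in auto)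
  also have "(\<Prod>a\<in>U. before y a * before x a) * - (\<Prod>a\<in>U. before y a * before x a)
     = - (\<Prod>a\<in>U. before y a * before x a * (before y a * before x a) :: 'a)"
    by (simp add: prod.distrib)
  also have "\<dots> = -1"
    by (simp add: before_def prod.neutral)
  finally show ?thesis .
qed

lemma sign_power_psum:
  "(-1 :: 'a::field) ^ psum (take k J) = (\<Prod>a\<in>odds J. before k a)"
proof (induction J arbitrary: k rule: rev_induct)
  case (snoc x J)
  have o: "odds (J @ [x]) = (if par x = 1 then insert (length J) (odds J) else odds J)"
    by (auto simp: odds_def nth_append less_Suc_eq split: if_splits)
  have n: "length J \<notin> odds J" by (simp add: odds_def)
  show ?case
  proof (cases "k \<le> length J")
    case True
    then show ?thesis using snoc[of k] o n
      by (auto simp: before_def)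
  next
    case False
    have *: "(\<Prod>a\<in>odds J. before k a) = (\<Prod>a\<in>odds J. before (length J) a :: 'a)"
      by (rule prod.cong) (use False in \<open>auto simp: before_def odds_def\<close>)
    show ?thesis using False snoc[of "length J"] o n par_cases[of x]
      by (auto simp: before_def[of k "length J"] psum_def * power_add)
  qed
qed (auto simp: psum_def odds_def)

lemma sign_power_sq: "(-1 :: 'a::field) ^ k * (-1) ^ k = 1"
  by (simp add: power_mult_distrib[symmetric])

text \<open>The inverse passed to \<open>csign\<close> cancels the one inside its definition, so
  inversions of \<open>\<sigma>\<close> itself are counted, at the odd positions of the permuted
  word.\<close>

lemma permact_koszul:
  assumes "\<sigma> permutes {..<length J}"
  shows "permact \<sigma> X J = koszul (odds (permute_list \<sigma> J)) \<sigma> * X (permute_list \<sigma> J)"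
proof -
  let ?I = "permute_list \<sigma> J"
  have I: "map (\<lambda>a. J ! \<sigma> a) [0..<length J] = ?I"
    by (simp add: permute_list_def)
  have inv: "inv (inv \<sigma>) = \<sigma>" using permutes_inv_inv[OF assms] .
  have inj: "inj \<sigma>" using permutes_inj[OF assms] .
  let ?P = "{(a, b). a \<in> odds ?I \<and> b \<in> odds ?I \<and> a < b}"
  let ?Q = "{(a, b). a < b \<and> b < length ?I \<and> par (?I ! a) = 1 \<and> par (?I ! b) = 1 \<and> \<sigma> a > \<sigma> b}"
  have fin: "finite ?P" by (rule finite_subset[of _ "odds ?I \<times> odds ?I"]) auto
  have Q: "?Q = ?P \<inter> {(a, b). \<sigma> a > \<sigma> b}" by (auto simp: odds_def)
  have "koszul (odds ?I) \<sigma> = (\<Prod>q\<in>?P. if q \<in> {(a, b). \<sigma> a > \<sigma> b} then -1 else 1 :: 'a)"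
    unfolding koszul_def
  proof (rule prod.cong, goal_cases)
    case (2 q)
    then show ?case using inj by (auto simp: pairsign_def inj_def) (metis linorder_neqE_nat less_irrefl)
  qed simp
  also have "\<dots> = (-1) ^ card ?Q"
    unfolding Q using fin by (subst prod.If_cases) (auto simp: Int_def)
  finally show ?thesis by (simp add: permact_def I inv csign_def Let_def)
qed

lemma odds_permute:
  assumes "\<sigma> permutes {..<length J}"
  shows "\<sigma> ` odds (permute_list \<sigma> J) = odds J"
proof -
  have lt: "\<sigma> a < length J \<longleftrightarrow> a < length J" for a
    using permutes_in_image[OF assms, of a] by simp
  have "odds (permute_list \<sigma> J) = \<sigma> -` odds J"
    by (auto simp: odds_def lt permute_list_nth[OF assms])
  then show ?thesis using permutes_surj[OF assms] by (simp add: surj_image_vimage_eq)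
qed

lemma permact_comp:
  assumes "\<sigma> permutes {..<length J}" "\<tau> permutes {..<length J}"
  shows "permact \<sigma> (permact \<tau> X) J = (permact (\<sigma> \<circ> \<tau>) X J :: 'a::field)"
proof -
  let ?S = "odds (permute_list \<tau> (permute_list \<sigma> J))"
  have "(koszul ?S (\<sigma> \<circ> \<tau>) :: 'a) = koszul (\<tau> ` ?S) \<sigma> * koszul ?S \<tau>"
    by (rule koszul_comp) (auto intro: inj_on_subset[OF permutes_inj[OF assms(1)]]
        inj_on_subset[OF permutes_inj[OF assms(2)]])
  moreover have "\<tau> ` ?S = odds (permute_list \<sigma> J)"
    by (rule odds_permute) (use assms in simp)
  moreover have "(\<sigma> \<circ> \<tau>) permutes {..<length J}" using assms by (simp add: permutes_compose)
  moreover have "permact \<sigma> (permact \<tau> X) J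
      = koszul (odds (permute_list \<sigma> J)) \<sigma> * (koszul ?S \<tau> * X (permute_list \<tau> (permute_list \<sigma> J)))"
    using assms by (simp add: permact_koszul)
  ultimately show ?thesis
    by (simp only: permact_koszul permute_list_compose[OF assms(2)] mult.assoc)
qed

lemma permact_cong:
  assumes "\<sigma> permutes {..<length J}" "\<And>I. length I = length J \<Longrightarrow> X I = Y I"
  shows "permact \<sigma> X J = permact \<sigma> Y J"
  using assms by (simp add: permact_koszul)

lemma permact_sum: "permact \<sigma> (\<lambda>I. \<Sum>x\<in>A. f x I) J = (\<Sum>x\<in>A. permact \<sigma> (f x) J)"
  by (simp add: permact_def Let_def sum_distrib_left)

lemma permact_scale: "permact \<sigma> (\<lambda>I. c * f I) J = c * permact \<sigma> f J"
  by (simp add: permact_def Let_def)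

lemma permact_scale_right: "permact \<sigma> (\<lambda>I. f I * c) J = permact \<sigma> f J * c"
  by (simp add: permact_def Let_def)

section \<open>The action of the general linear Lie superalgebra on one tensor power\<close>

text \<open>The coefficient function of \<open>E\<^sub>a\<^sub>b X\<close>: it is the transpose of \<open>e\<^sub>b \<mapsto> e\<^sub>a\<close>, so a letter \<open>a\<close> of the
  argument is replaced by \<open>b\<close>.\<close>

definition super_deriv :: "idx \<Rightarrow> idx \<Rightarrow> (idx list \<Rightarrow> 'a::field) \<Rightarrow> idx list \<Rightarrow> 'a" where
  "super_deriv a b X J = (\<Sum>k<length J.
     if J ! k = a then (-1) ^ ((par a + par b) * psum (take k J)) * X (J[k := b]) else 0)"

lemma permute_list_update:
  assumes "\<sigma> permutes {..<length J}" "k < length J"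
  shows "permute_list \<sigma> (J[\<sigma> k := b]) = (permute_list \<sigma> J)[k := b]"
proof (rule nth_equalityI)
  fix i assume "i < length (permute_list \<sigma> (J[\<sigma> k := b]))"
  then have i: "i < length J" by simp
  have lt: "\<sigma> a < length J \<longleftrightarrow> a < length J" for a
    using permutes_in_image[OF assms(1), of a] by simp
  show "permute_list \<sigma> (J[\<sigma> k := b]) ! i = (permute_list \<sigma> J)[k := b] ! i"
    using assms i lt permutes_inj[OF assms(1)]
    by (auto simp: permute_list_nth nth_list_update inj_def)
qed simp

text \<open>Changing the parity of one letter changes the Koszul sign by its pair signs with all
  other odd letters. By \<open>pairsign_before\<close> these are the operator sign at
  \<open>k\<close> times the one at \<open>\<sigma> k\<close>, so the discrepancy is exactly
  absorbed. For equal parities the exponents are even.\<close>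

lemma koszul_odds_update:
  fixes I :: "idx list"
  assumes \<sigma>: "\<sigma> permutes {..<length J}" and k: "k < length J"
    and I: "I = permute_list \<sigma> J"
  shows "(koszul (odds I) \<sigma> :: 'a::field) * (-1) ^ ((par (I ! k) + par b) * psum (take k I))
       = (-1) ^ ((par (I ! k) + par b) * psum (take (\<sigma> k) J)) * koszul (odds (I[k := b])) \<sigma>"
proof -
  \<comment> \<open>The odd positions other than \<open>k\<close>, common to \<open>I\<close> and
    \<open>I[k := b]\<close>.\<close>
  define U where "U = odds I - {k}"
  have len: "length I = length J" by (simp add: I)
  have U: "finite U" "k \<notin> U" by (auto simp: U_def)
  have o1: "odds I = (if par (I ! k) = 1 then insert k U else U)"
    using k len by (auto simp: U_def odds_def)
  have o2: "odds (I[k := b]) = (if par b = 1 then insert k U else U)"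
    using k len by (auto simp: U_def odds_def nth_list_update)
  have inj: "inj \<sigma>" using permutes_inj[OF \<sigma>] .
  have "(\<Prod>a\<in>odds J. before (\<sigma> k) a) = (\<Prod>a\<in>odds I. before (\<sigma> k) (\<sigma> a) :: 'a)"
    unfolding odds_permute[OF \<sigma>, symmetric] I
    by (subst prod.reindex) (auto intro: inj_on_subset[OF inj])
  also have "\<dots> = (\<Prod>a\<in>U. before (\<sigma> k) (\<sigma> a))"
    using U by (simp add: o1 before_def)
  finally have p1: "(-1) ^ psum (take (\<sigma> k) J) = (\<Prod>a\<in>U. before (\<sigma> k) (\<sigma> a) :: 'a)"
    by (simp add: sign_power_psum)
  have p2: "(-1) ^ psum (take k I) = (\<Prod>a\<in>U. before k a :: 'a)"
    using U by (simp add: sign_power_psum o1 before_def)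
  have ins: "koszul (insert k U) \<sigma>
      = koszul U \<sigma> * (\<Prod>a\<in>U. before k a) * (\<Prod>a\<in>U. before (\<sigma> k) (\<sigma> a) :: 'a)"
    using koszul_insert[OF U inj_on_subset[OF inj subset_UNIV], where 'a = 'a]
    by (simp add: pairsign_before prod.distrib mult.assoc)
  have sq: "(\<Prod>a\<in>U. f a) * (\<Prod>a\<in>U. f a) = 1" if "\<And>a. f a * f a = 1" for f :: "nat \<Rightarrow> 'a"
    using that by (simp add: prod.distrib[symmetric])
  define p q where "p = (\<Prod>a\<in>U. before k a :: 'a)" and "q = (\<Prod>a\<in>U. before (\<sigma> k) (\<sigma> a) :: 'a)"
  have pp: "p * p = 1" and qq: "q * q = 1"
    unfolding p_def q_def by (rule sq; simp add: before_def)+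
  have "koszul U \<sigma> * p * q * p = koszul U \<sigma> * q * (p * p)"
    "q * (koszul U \<sigma> * p * q) = koszul U \<sigma> * p * (q * q)"
    by (simp_all only: mult_ac)
  then have pq: "koszul U \<sigma> * p * q * p = q * koszul U \<sigma>" "q * (koszul U \<sigma> * p * q) = koszul U \<sigma> * p"
    unfolding pp qq by simp_all
  show ?thesis
    using par_cases[of "I ! k"] par_cases[of b]
  proof (elim disjE)
    assume "par (I ! k) = 0" "par b = 1"
    then show ?thesis using pq(2) by (simp add: o1 o2 p1 p2 ins p_def q_def)
  next
    assume "par (I ! k) = 1" "par b = 0"
    then show ?thesis using pq(1) by (simp add: o1 o2 p1 p2 ins p_def q_def)
  qed (simp_all add: o1 o2 power_mult)
qed

text \<open>The two actions commute: reindexing the positions by \<open>\<sigma>\<close> matches the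
  letters, and \<open>koszul_odds_update\<close> matches the signs.\<close>

lemma permact_super_deriv:
  assumes \<sigma>: "\<sigma> permutes {..<length J}"
  shows "permact \<sigma> (super_deriv a b X) J = super_deriv a b (permact \<sigma> X) J"
proof -
  let ?I = "permute_list \<sigma> J"
  have bij: "bij_betw \<sigma> {..<length J} {..<length J}" using permutes_imp_bij[OF \<sigma>] .
  have \<sigma>': "\<sigma> permutes {..<length (J[k := c])}" for k c using \<sigma> by simp
  have "super_deriv a b (permact \<sigma> X) J = (\<Sum>k<length J. if J ! \<sigma> k = a
      then (-1) ^ ((par a + par b) * psum (take (\<sigma> k) J)) * permact \<sigma> X (J[\<sigma> k := b]) else 0)"
    unfolding super_deriv_def by (rule sum.reindex_bij_betw[OF bij, symmetric])
  also have "\<dots> = (\<Sum>k<length J. koszul (odds ?I) \<sigma> * (if ?I ! k = a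
      then (-1) ^ ((par a + par b) * psum (take k ?I)) * X (?I[k := b]) else 0))"
  proof (rule sum.cong, goal_cases)
    case (2 k)
    then have k: "k < length J" by simp
    have *: "permact \<sigma> X (J[\<sigma> k := b]) = koszul (odds (?I[k := b])) \<sigma> * X (?I[k := b])"
      by (simp only: permact_koszul[OF \<sigma>'] permute_list_update[OF \<sigma> k])
    have **: "?I ! k = J ! \<sigma> k" using \<sigma> k by (rule permute_list_nth)
    show ?case
    proof (cases "J ! \<sigma> k = a")
      case True
      show ?thesis
        using koszul_odds_update[OF \<sigma> k refl, of b, where 'a = 'a]
        unfolding * ** True by (simp only: mult.assoc[symmetric] if_True refl)
    qed (simp add: **)
  qed simp
  also have "\<dots> = permact \<sigma> (super_deriv a b X) J"
    by (simp add: permact_koszul[OF \<sigma>] super_deriv_def sum_distrib_left)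
  finally show ?thesis by simp
qed

lemma super_deriv_cong:
  assumes "\<And>I. length I = length J \<Longrightarrow> X I = Y I"
  shows "super_deriv a b X J = super_deriv a b Y J"
  unfolding super_deriv_def by (intro sum.cong) (use assms in auto)

lemma super_deriv_sum:
  "super_deriv a b (\<lambda>I. \<Sum>x\<in>A. f x I) J = (\<Sum>x\<in>A. super_deriv a b (f x) J)"
  unfolding super_deriv_def
  by (subst sum.swap, intro sum.cong) (auto simp: sum_distrib_left)

lemma super_deriv_scale: "super_deriv a b (\<lambda>I. c * f I) J = c * super_deriv a b f J"
  unfolding super_deriv_def sum_distrib_left by (intro sum.cong) auto

lemma super_deriv_scale_right: "super_deriv a b (\<lambda>I. f I * c) J = super_deriv a b f J * c"
  unfolding super_deriv_def sum_distrib_right by (intro sum.cong) auto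

lemma super_deriv_diff:
  "super_deriv a b (\<lambda>I. f I - g I) J = super_deriv a b f J - super_deriv a b g J"
  unfolding super_deriv_def sum_subtractf[symmetric] by (intro sum.cong) (auto simp: algebra_simps)

lemma young_e_super_deriv:
  assumes "length J = r * c"
  shows "young_e T r c (super_deriv a b X) J = super_deriv a b (young_e T r c X) J"
proof -
  have "permact \<sigma> (permact \<tau> (super_deriv a b X)) J = super_deriv a b (permact \<sigma> (permact \<tau> X)) J"
    if "\<tau> permutes {..<length J}" "\<sigma> permutes {..<length J}" for \<sigma> \<tau>
  proof -
    have "permact \<sigma> (permact \<tau> (super_deriv a b X)) J = permact \<sigma> (super_deriv a b (permact \<tau> X)) J"
      by (rule permact_cong) (use that in \<open>auto simp: permact_super_deriv\<close>)
    then show ?thesis using that by (simp add: permact_super_deriv)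
  qed
  then have "young_e T r c (super_deriv a b X) J = (\<Sum>\<tau>\<in>colgrp T r c. \<Sum>\<sigma>\<in>rowgrp T r c.
       of_int (sign \<tau>) * super_deriv a b (permact \<sigma> (permact \<tau> X)) J)"
    unfolding young_e_def using assms
    by (intro sum.cong) (auto simp: rowgrp_def colgrp_def atLeast0LessThan)
  also have "\<dots> = super_deriv a b (young_e T r c X) J"
    unfolding young_e_def by (simp only: super_deriv_sum super_deriv_scale)
  finally show ?thesis .
qed

lemma young_e'_super_deriv:
  assumes "length J = r * c"
  shows "young_e' T r c (super_deriv a b X) J = super_deriv a b (young_e' T r c X) J"
proof -
  have "permact \<sigma> (permact \<tau> (super_deriv a b X)) J = super_deriv a b (permact \<sigma> (permact \<tau> X)) J"
    if "\<tau> permutes {..<length J}" "\<sigma> permutes {..<length J}" for \<sigma> \<tau>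
  proof -
    have "permact \<sigma> (permact \<tau> (super_deriv a b X)) J = permact \<sigma> (super_deriv a b (permact \<tau> X)) J"
      by (rule permact_cong) (use that in \<open>auto simp: permact_super_deriv\<close>)
    then show ?thesis using that by (simp add: permact_super_deriv)
  qed
  then have "young_e' T r c (super_deriv a b X) J = (\<Sum>\<tau>\<in>colgrp T r c. \<Sum>\<sigma>\<in>rowgrp T r c.
       of_int (sign \<tau>) * super_deriv a b (permact \<tau> (permact \<sigma> X)) J)"
    unfolding young_e'_def using assms
    by (intro sum.cong) (auto simp: rowgrp_def colgrp_def atLeast0LessThan)
  also have "\<dots> = super_deriv a b (young_e' T r c X) J"
    unfolding young_e'_def by (simp only: super_deriv_sum super_deriv_scale)
  finally show ?thesis .
qed

section \<open>Row and column symmetries of the Young symmetrizers\<close>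

lemma rowgrp_permutes: "\<sigma> \<in> rowgrp T r c \<Longrightarrow> \<sigma> permutes {..<r * c}"
  by (simp add: rowgrp_def atLeast0LessThan)

lemma colgrp_permutes: "\<sigma> \<in> colgrp T r c \<Longrightarrow> \<sigma> permutes {..<r * c}"
  by (simp add: colgrp_def atLeast0LessThan)

lemma rowgrp_comp: "\<sigma> \<in> rowgrp T r c \<Longrightarrow> \<tau> \<in> rowgrp T r c \<Longrightarrow> \<sigma> \<circ> \<tau> \<in> rowgrp T r c"
  unfolding rowgrp_def mem_Collect_eq image_comp[symmetric] by (simp add: permutes_compose)

lemma colgrp_comp: "\<sigma> \<in> colgrp T r c \<Longrightarrow> \<tau> \<in> colgrp T r c \<Longrightarrow> \<sigma> \<circ> \<tau> \<in> colgrp T r c"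
  unfolding colgrp_def mem_Collect_eq image_comp[symmetric] by (simp add: permutes_compose)

lemma transpose_image_eq: "x \<in> A \<longleftrightarrow> y \<in> A \<Longrightarrow> transpose x y ` A = A"
  using bij_betw_transpose_iff[of x A y] by (simp add: bij_betw_def)

lemma transpose_in_rowgrp:
  assumes "x < r * c" "y < r * c"
    "\<And>i. i < r \<Longrightarrow> x \<in> {T i j | j. j < c} \<longleftrightarrow> y \<in> {T i j | j. j < c}"
  shows "transpose x y \<in> rowgrp T r c"
  unfolding rowgrp_def
  by (intro CollectI conjI allI impI transpose_image_eq permutes_swap_id) (use assms in simp_all)

lemma transpose_in_colgrp:
  assumes "x < r * c" "y < r * c"
    "\<And>j. j < c \<Longrightarrow> x \<in> {T i j | i. i < r} \<longleftrightarrow> y \<in> {T i j | i. i < r}"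
  shows "transpose x y \<in> colgrp T r c"
  unfolding colgrp_def
  by (intro CollectI conjI allI impI transpose_image_eq permutes_swap_id) (use assms in simp_all)

lemma sum_comp_transpose_left:
  assumes "\<And>\<sigma>. \<sigma> \<in> G \<Longrightarrow> transpose x y \<circ> \<sigma> \<in> G"
  shows "(\<Sum>\<sigma>\<in>G. f (transpose x y \<circ> \<sigma>)) = (\<Sum>\<sigma>\<in>G. f \<sigma>)"
  by (rule sum.reindex_bij_witness[of _ "\<lambda>\<sigma>. transpose x y \<circ> \<sigma>" "\<lambda>\<sigma>. transpose x y \<circ> \<sigma>"])
    (use assms in \<open>auto simp: comp_assoc[symmetric]\<close>)

lemma sum_comp_transpose_right:
  assumes "\<And>\<sigma>. \<sigma> \<in> G \<Longrightarrow> \<sigma> \<circ> transpose x y \<in> G"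
  shows "(\<Sum>\<sigma>\<in>G. f (\<sigma> \<circ> transpose x y)) = (\<Sum>\<sigma>\<in>G. f \<sigma>)"
  by (rule sum.reindex_bij_witness[of _ "\<lambda>\<sigma>. \<sigma> \<circ> transpose x y" "\<lambda>\<sigma>. \<sigma> \<circ> transpose x y"])
    (use assms in \<open>auto simp: comp_assoc\<close>)

lemma sign_comp_transpose:
  assumes "\<tau> permutes {..<N::nat}" "x \<noteq> y"
  shows "sign (transpose x y \<circ> \<tau>) = - sign \<tau>" "sign (\<tau> \<circ> transpose x y) = - sign \<tau>"
proof -
  have "permutation \<tau>" using assms(1) by (auto simp: permutation_permutes)
  then show "sign (transpose x y \<circ> \<tau>) = - sign \<tau>" "sign (\<tau> \<circ> transpose x y) = - sign \<tau>"
    using assms(2) by (simp_all add: sign_compose permutation_swap_id sign_swap_id)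
qed

text \<open>In \<open>young_e\<close> the row permutations act last and without sign, so composing
  with a row transposition merely permutes the summands.\<close>

lemma young_e_row_symmetric:
  assumes J: "length J = r * c" and \<pi>: "transpose x y \<in> rowgrp T r c"
  shows "permact (transpose x y) (young_e T r c X) J = young_e T r c X J"
proof -
  let ?\<pi> = "transpose x y"
  have "permact ?\<pi> (young_e T r c X) J = (\<Sum>\<tau>\<in>colgrp T r c. \<Sum>\<sigma>\<in>rowgrp T r c.
      of_int (sign \<tau>) * permact ?\<pi> (permact \<sigma> (permact \<tau> X)) J)"
    unfolding young_e_def by (simp only: permact_sum permact_scale)
  also have "\<dots> = (\<Sum>\<tau>\<in>colgrp T r c. \<Sum>\<sigma>\<in>rowgrp T r c.
      of_int (sign \<tau>) * permact (?\<pi> \<circ> \<sigma>) (permact \<tau> X) J)"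
    by (intro sum.cong refl arg_cong2[where f = "(*)"] permact_comp)
      (use J rowgrp_permutes[OF \<pi>] in \<open>auto dest: rowgrp_permutes\<close>)
  also have "\<dots> = young_e T r c X J"
    unfolding young_e_def
    by (intro sum.cong refl sum_comp_transpose_left rowgrp_comp[OF \<pi>])
  finally show ?thesis .
qed

text \<open>In \<open>young_e'\<close> the column permutations act last, weighted by their sign, so
  reindexing by a column transposition costs a sign.\<close>

lemma young_e'_col_antisymmetric:
  assumes J: "length J = r * c" and \<pi>: "transpose x y \<in> colgrp T r c" and "x \<noteq> y"
  shows "permact (transpose x y) (young_e' T r c X) J = - young_e' T r c X J"
proof -
  let ?\<pi> = "transpose x y"
  have "permact ?\<pi> (young_e' T r c X) J = (\<Sum>\<tau>\<in>colgrp T r c. \<Sum>\<sigma>\<in>rowgrp T r c.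
      of_int (sign \<tau>) * permact ?\<pi> (permact \<tau> (permact \<sigma> X)) J)"
    unfolding young_e'_def by (simp only: permact_sum permact_scale)
  also have "\<dots> = (\<Sum>\<tau>\<in>colgrp T r c. - (\<Sum>\<sigma>\<in>rowgrp T r c.
      of_int (sign (?\<pi> \<circ> \<tau>)) * permact (?\<pi> \<circ> \<tau>) (permact \<sigma> X) J))"
    unfolding sum_negf[symmetric]
  proof (intro sum.cong refl, goal_cases)
    case (1 \<tau> \<sigma>)
    then show ?case
      using sign_comp_transpose(1)[OF colgrp_permutes \<open>x \<noteq> y\<close>] J colgrp_permutes[OF \<pi>]
      by (simp add: permact_comp colgrp_permutes)
  qed
  also have "\<dots> = - young_e' T r c X J"
    unfolding young_e'_def sum_negf
    by (intro arg_cong[where f = uminus] sum_comp_transpose_left colgrp_comp[OF \<pi>])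
  finally show ?thesis .
qed

text \<open>The column permutations act first here. Composing each with the transposition leaves its
  effect on \<open>X\<close> unchanged but flips \<open>sign\<close>, so the sum equals its own
  negative; characteristic 0 makes it vanish.\<close>

lemma young_e_col_vanish:
  fixes X :: "idx list \<Rightarrow> 'a::field_char_0"
  assumes J: "length J = r * c" and \<pi>: "transpose x y \<in> colgrp T r c" and "x \<noteq> y"
    and X: "\<And>I. length I = r * c \<Longrightarrow> permact (transpose x y) X I = X I"
  shows "young_e T r c X J = 0"
proof -
  let ?\<pi> = "transpose x y"
  let ?f = "\<lambda>\<tau>. \<Sum>\<sigma>\<in>rowgrp T r c. of_int (sign \<tau>) * permact \<sigma> (permact \<tau> X) J"
  have "?f (\<tau> \<circ> ?\<pi>) = - ?f \<tau>" if "\<tau> \<in> colgrp T r c" for \<tau>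
  proof -
    have "permact \<sigma> (permact (\<tau> \<circ> ?\<pi>) X) J = permact \<sigma> (permact \<tau> X) J" if "\<sigma> \<in> rowgrp T r c" for \<sigma>
    proof (rule permact_cong)
      fix I :: "idx list" assume "length I = length J"
      then have I: "length I = r * c" using J by simp
      have "permact (\<tau> \<circ> ?\<pi>) X I = permact \<tau> (permact ?\<pi> X) I"
        by (rule permact_comp[symmetric])
          (use I colgrp_permutes[OF \<pi>] colgrp_permutes[OF \<open>\<tau> \<in> _\<close>] in auto)
      also have "\<dots> = permact \<tau> X I"
        by (rule permact_cong) (use I X colgrp_permutes[OF \<open>\<tau> \<in> _\<close>] in auto)
      finally show "permact (\<tau> \<circ> ?\<pi>) X I = permact \<tau> X I" .
    qed (use J that in \<open>auto dest: rowgrp_permutes\<close>)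
    then show ?thesis
      using sign_comp_transpose(2)[OF colgrp_permutes[OF that] \<open>x \<noteq> y\<close>]
      by (simp add: sum_negf[symmetric])
  qed
  then have "(\<Sum>\<tau>\<in>colgrp T r c. ?f (\<tau> \<circ> ?\<pi>)) = - young_e T r c X J"
    unfolding young_e_def by (simp add: sum_negf)
  moreover have "(\<Sum>\<tau>\<in>colgrp T r c. ?f (\<tau> \<circ> ?\<pi>)) = young_e T r c X J"
    unfolding young_e_def by (rule sum_comp_transpose_right) (use colgrp_comp \<pi> in auto)
  ultimately show ?thesis by simp
qed

text \<open>The dual situation: the row permutations act first and carry no sign, so an
  \<open>X\<close> antisymmetric under a row transposition gives a sum equal to its own
  negative.\<close>

lemma young_e'_row_vanish:
  fixes X :: "idx list \<Rightarrow> 'a::field_char_0"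
  assumes J: "length J = r * c" and \<pi>: "transpose x y \<in> rowgrp T r c"
    and X: "\<And>I. length I = r * c \<Longrightarrow> permact (transpose x y) X I = - X I"
  shows "young_e' T r c X J = 0"
proof -
  let ?\<pi> = "transpose x y"
  have "(\<Sum>\<sigma>\<in>rowgrp T r c. of_int (sign \<tau>) * permact \<tau> (permact \<sigma> X) J) = 0"
    if \<tau>: "\<tau> \<in> colgrp T r c" for \<tau>
  proof -
    let ?f = "\<lambda>\<sigma>. of_int (sign \<tau>) * permact \<tau> (permact \<sigma> X) J"
    have "?f (\<sigma> \<circ> ?\<pi>) = - ?f \<sigma>" if "\<sigma> \<in> rowgrp T r c" for \<sigma>
    proof -
      have "permact \<tau> (permact (\<sigma> \<circ> ?\<pi>) X) J = permact \<tau> (\<lambda>I. (-1) * permact \<sigma> X I) J"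
      proof (rule permact_cong)
        fix I :: "idx list" assume "length I = length J"
        then have I: "length I = r * c" using J by simp
        have "permact (\<sigma> \<circ> ?\<pi>) X I = permact \<sigma> (permact ?\<pi> X) I"
          by (rule permact_comp[symmetric])
            (use I rowgrp_permutes[OF \<pi>] rowgrp_permutes[OF \<open>\<sigma> \<in> _\<close>] in auto)
        also have "\<dots> = permact \<sigma> (\<lambda>I. (-1) * X I) I"
          by (rule permact_cong) (use I X rowgrp_permutes[OF \<open>\<sigma> \<in> _\<close>] in auto)
        finally show "permact (\<sigma> \<circ> ?\<pi>) X I = (-1) * permact \<sigma> X I"
          by (simp only: permact_scale)
      qed (use J \<tau> in \<open>auto dest: colgrp_permutes\<close>)
      then show ?thesis by (simp only: permact_scale) simp
    qed
    then have "(\<Sum>\<sigma>\<in>rowgrp T r c. ?f (\<sigma> \<circ> ?\<pi>)) = - sum ?f (rowgrp T r c)"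
      by (simp add: sum_negf)
    moreover have "(\<Sum>\<sigma>\<in>rowgrp T r c. ?f (\<sigma> \<circ> ?\<pi>)) = sum ?f (rowgrp T r c)"
      by (rule sum_comp_transpose_right) (use rowgrp_comp \<pi> in auto)
    ultimately show ?thesis by simp
  qed
  then show ?thesis unfolding young_e'_def by (simp add: sum.neutral)
qed

section \<open>Symmetrized basis tensors: vanishing and letter content\<close>

lemma permute_list_transpose_eq:
  assumes "x < length P" "y < length P" "P ! x = P ! y" "length J = length P"
  shows "permute_list (transpose x y) J = P \<longleftrightarrow> J = P"
proof -
  have perm: "transpose x y permutes {..<length P}"
    using assms by (intro permutes_swap_id) auto
  have P: "permute_list (transpose x y) P = P"
    by (rule nth_equalityI) (use assms perm in \<open>auto simp: permute_list_nth transpose_def\<close>)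
  have J: "permute_list (transpose x y) (permute_list (transpose x y) J) = J"
    using perm assms by (simp add: permute_list_compose[symmetric])
  show ?thesis using P J by metis
qed

lemma permact_transpose_basis:
  assumes "x < length P" "y < length P" "P ! x = P ! y" "length J = length P"
  shows "permact (transpose x y) (basis_v P) J = koszul (odds P) (transpose x y) * basis_v P J"
proof -
  have "transpose x y permutes {..<length J}"
    using assms by (intro permutes_swap_id) auto
  then show ?thesis
    using permute_list_transpose_eq[OF assms] by (auto simp: permact_koszul basis_v_def)
qed

text \<open>Exchanging equal even letters costs no Koszul sign, which is the symmetry that the
  column antisymmetrizer kills.\<close>

lemma young_e_basis_vanish:
  assumes "length J = r * c" "length P = r * c" "transpose x y \<in> colgrp T r c" "x \<noteq> y"
    "x < r * c" "y < r * c" "P ! x = Ev i" "P ! y = Ev i"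
  shows "young_e T r c (basis_v P) J = (0 :: 'a::field_char_0)"
proof (rule young_e_col_vanish)
  fix I :: "idx list" assume I: "length I = r * c"
  have "koszul (odds P) (transpose x y) = (1 :: 'a)"
    by (rule koszul_fixed) (use assms in \<open>auto simp: odds_def transpose_def\<close>)
  then show "permact (transpose x y) (basis_v P) I = (basis_v P I :: 'a)"
    using assms I by (simp add: permact_transpose_basis)
qed (use assms in auto)

text \<open>Exchanging equal odd letters costs the Koszul sign -1, which is the antisymmetry that
  the row symmetrizer kills.\<close>

lemma young_e'_basis_vanish:
  assumes "length J = r * c" "length P = r * c" "transpose x y \<in> rowgrp T r c" "x \<noteq> y"
    "x < r * c" "y < r * c" "P ! x = Od i" "P ! y = Od i"
  shows "young_e' T r c (basis_v P) J = (0 :: 'a::field_char_0)"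
proof (rule young_e'_row_vanish)
  fix I :: "idx list" assume I: "length I = r * c"
  have "koszul (odds P) (transpose x y) = (-1 :: 'a)"
    by (rule koszul_transpose_both) (use assms in \<open>auto simp: odds_def\<close>)
  then show "permact (transpose x y) (basis_v P) I = - (basis_v P I :: 'a)"
    using assms I by (simp add: permact_transpose_basis)
qed (use assms in auto)

lemma young_e_support:
  assumes "young_e T r c (basis_v P) J \<noteq> (0 :: 'a::field)" "length J = r * c"
  shows "mset J = mset P"
proof -
  have p: "\<tau> permutes {..<length J}" "\<sigma> permutes {..<length J}"
    if "\<tau> \<in> colgrp T r c" "\<sigma> \<in> rowgrp T r c" for \<sigma> \<tau>
    using that assms(2) by (auto dest: rowgrp_permutes colgrp_permutes)
  have zero: "permact \<sigma> (permact \<tau> (basis_v P)) J = (0 :: 'a)"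
    if "\<tau> \<in> colgrp T r c" "\<sigma> \<in> rowgrp T r c" "mset J \<noteq> mset P" for \<sigma> \<tau>
  proof -
    have "mset (permute_list \<tau> (permute_list \<sigma> J)) = mset J"
      using p[OF that(1,2)] by simp
    then have "permute_list \<tau> (permute_list \<sigma> J) \<noteq> P" using that(3) by metis
    then show ?thesis using p[OF that(1,2)] by (simp add: permact_koszul basis_v_def)
  qed
  show ?thesis
  proof (rule ccontr)
    assume "mset J \<noteq> mset P"
    then have "young_e T r c (basis_v P) J = (0 :: 'a)"
      unfolding young_e_def by (intro sum.neutral ballI) (simp add: zero)
    then show False using assms(1) by simp
  qed
qed

lemma young_e'_support:
  assumes "young_e' T r c (basis_v P) J \<noteq> (0 :: 'a::field)" "length J = r * c"
  shows "mset J = mset P"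
proof -
  have p: "\<tau> permutes {..<length J}" "\<sigma> permutes {..<length J}"
    if "\<tau> \<in> colgrp T r c" "\<sigma> \<in> rowgrp T r c" for \<sigma> \<tau>
    using that assms(2) by (auto dest: rowgrp_permutes colgrp_permutes)
  have zero: "permact \<tau> (permact \<sigma> (basis_v P)) J = (0 :: 'a)"
    if "\<tau> \<in> colgrp T r c" "\<sigma> \<in> rowgrp T r c" "mset J \<noteq> mset P" for \<sigma> \<tau>
  proof -
    have "mset (permute_list \<sigma> (permute_list \<tau> J)) = mset J"
      using p[OF that(1,2)] by simp
    then have "permute_list \<sigma> (permute_list \<tau> J) \<noteq> P" using that(3) by metis
    then show ?thesis using p[OF that(1,2)] by (simp add: permact_koszul basis_v_def)
  qed
  show ?thesis
  proof (rule ccontr)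
    assume "mset J \<noteq> mset P"
    then have "young_e' T r c (basis_v P) J = (0 :: 'a)"
      unfolding young_e'_def by (intro sum.neutral ballI) (simp add: zero)
    then show False using assms(1) by simp
  qed
qed

lemma psum_mset: "mset J = mset P \<Longrightarrow> psum J = psum P"
  unfolding psum_def by (metis mset_map sum_mset_sum_list)

section \<open>The action on mixed tensors\<close>

text \<open>The action of the matrix unit \<open>E_ab\<close> in coefficient form. The dual factor
  exchanges \<open>a\<close> and \<open>b\<close>; its exponent joins the sign of the contragredient
  action with the sign of passing \<open>v_I\<close>, whose parity is \<open>psum I\<close>.\<close>

definition gl_op :: "idx \<Rightarrow> idx \<Rightarrow> (idx list \<Rightarrow> idx list \<Rightarrow> 'a::field) \<Rightarrow> idx list \<Rightarrow> idx list \<Rightarrow> 'a" where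
  "gl_op a b X I K = super_deriv a b (\<lambda>I. X I K) I
     - (-1) ^ ((par a + par b) * (par a + psum I)) * super_deriv b a (X I) K"

lemma list_update_iff:
  assumes "k < length I"
  shows "(I ! k = b \<and> I' = I[k := a]) \<longleftrightarrow> (length I = length I' \<and> I' ! k = a \<and> I = I'[k := b])"
  using assms by (auto simp: list_update_same_conv)

lemma finite_RV [simp]: "finite (RV n m)"
  by (simp add: RV_def)

lemma finite_seqs [simp]: "finite (seqs n m N)"
  using finite_lists_length_eq[of "RV n m" N] by (simp add: seqs_def conj_commute)

text \<open>For a given target and position there is only one source word, so the sums over basis
  vectors collapse. The support hypothesis ensures that no nonzero coefficient lies outside the
  range of summation.\<close>

lemma sum_gl_basis:
  fixes X :: "idx list \<Rightarrow> idx list \<Rightarrow> 'a::field"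
  assumes X: "\<And>I K. X I K \<noteq> 0 \<Longrightarrow> I \<in> seqs n m p \<and> K \<in> seqs n m q"
  shows "(\<Sum>I\<in>seqs n m p. \<Sum>K\<in>seqs n m q. X I K * gl_basis a b I K I' K') = gl_op a b X I' K'"
proof -
  have tk: "take k (I'[k := b]) = take k I'" for k :: nat and I' :: "idx list" and b by simp
  have first: "(\<Sum>I\<in>seqs n m p. \<Sum>K\<in>seqs n m q. X I K *
      (\<Sum>k<length I. if I!k = b \<and> I' = I[k := a] \<and> K' = K
        then (-1) ^ ((par a + par b) * psum (take k I)) else 0)) = super_deriv a b (\<lambda>I. X I K') I'"
    (is "?L = ?R")
  proof -
    have "?L = (\<Sum>I\<in>seqs n m p. \<Sum>K\<in>seqs n m q. \<Sum>k<length I'. if K = K' then if I = I'[k := b]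
       then if I' ! k = a then (-1) ^ ((par a + par b) * psum (take k I')) * X (I'[k := b]) K' else 0 else 0 else 0)"
    proof (intro sum.cong refl, goal_cases)
      case (1 I K)
      show ?case
      proof (cases "length I = length I'")
        case True
        show ?thesis unfolding sum_distrib_left True
        proof (intro sum.cong refl, goal_cases)
          case (1 k)
          then have iff: "(I ! k = b \<and> I' = I[k := a]) = (I' ! k = a \<and> I = I'[k := b])"
            using list_update_iff[of k I b I' a] True by simp
          have "take k I = take k I'" if "I = I'[k := b]" using that tk by metis
          then show ?case unfolding conj_assoc[symmetric] iff by (cases "I = I'[k := b]") simp_all
        qed
      next
        case False
        then have "I \<noteq> I'[k := b]" "I' \<noteq> I[k := a]" for k by auto
        then show ?thesis by (simp cong: if_cong)
      qed
    qed
    also have "\<dots> = (\<Sum>k<length I'. \<Sum>I\<in>seqs n m p. \<Sum>K\<in>seqs n m q. if K = K' then if I = I'[k := b]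
       then if I' ! k = a then (-1) ^ ((par a + par b) * psum (take k I')) * X (I'[k := b]) K' else 0 else 0 else 0)"
      by (simp only: sum.swap[of _ "{..<length I'}"])
    also have "\<dots> = ?R"
      unfolding super_deriv_def
    proof (intro sum.cong refl, goal_cases)
      case (1 k)
      show ?case
      \<comment> \<open>A nonzero coefficient places the source word inside \<open>seqs\<close>, so
        that the delta sums pick it up.\<close>
      proof (cases "X (I'[k := b]) K' = 0")
        case True
        then show ?thesis by (simp cong: if_cong)
      next
        case False
        then show ?thesis using X[OF False] by (simp add: sum.delta)
      qed
    qed
    finally show ?thesis .
  qed
  have second: "(\<Sum>I\<in>seqs n m p. \<Sum>K\<in>seqs n m q. X I K *
      (\<Sum>k<length K. if K!k = a \<and> I' = I \<and> K' = K[k := b]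
        then - ((-1) ^ ((par a + par b) * par a)
                * (-1) ^ ((par a + par b) * (psum I + psum (take k K)))) else 0))
      = - ((-1) ^ ((par a + par b) * (par a + psum I')) * super_deriv b a (X I') K')"
    (is "?L = ?R")
  proof -
    let ?t = "\<lambda>k. (if K' ! k = b then - ((-1) ^ ((par a + par b) * (par a + psum I'))
          * ((-1) ^ ((par b + par a) * psum (take k K')) * X I' (K'[k := a]))) else 0)"
    have "?L = (\<Sum>I\<in>seqs n m p. \<Sum>K\<in>seqs n m q. \<Sum>k<length K'. if I = I' then if K = K'[k := a]
       then ?t k else 0 else 0)"
    proof (intro sum.cong refl, goal_cases)
      case (1 I K)
      show ?case
      proof (cases "length K = length K'")
        case True
        show ?thesis unfolding sum_distrib_left True
        proof (intro sum.cong refl, goal_cases)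
          case (1 k)
          then have iff: "(K ! k = a \<and> K' = K[k := b]) = (K' ! k = b \<and> K = K'[k := a])"
            using list_update_iff[of k K a K' b] True by simp
          then have iff': "(K ! k = a \<and> I' = I \<and> K' = K[k := b]) = (I = I' \<and> K' ! k = b \<and> K = K'[k := a])"
            by blast
          have "take k K = take k K'" if "K = K'[k := a]" using that tk by metis
          then show ?case unfolding iff'
            by (cases "K = K'[k := a]"; cases "I = I'")
              (simp_all add: power_add[symmetric] distrib_left add.commute[of "par b"] add.assoc
                mult.assoc[symmetric])
        qed
      next
        case False
        then have "K \<noteq> K'[k := a]" "K' \<noteq> K[k := b]" for k by auto
        then show ?thesis by (simp cong: if_cong)
      qed
    qed
    also have "\<dots> = (\<Sum>k<length K'. \<Sum>I\<in>seqs n m p. \<Sum>K\<in>seqs n m q. if I = I' then if K = K'[k := a]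
       then ?t k else 0 else 0)"
      by (simp only: sum.swap[of _ "{..<length K'}"])
    also have "\<dots> = (\<Sum>k<length K'. ?t k)"
    proof (intro sum.cong refl, goal_cases)
      case (1 k)
      show ?case
      proof (cases "X I' (K'[k := a]) = 0")
        case True
        then show ?thesis by (simp cong: if_cong)
      next
        case False
        have "(\<Sum>K\<in>seqs n m q. if I = I' then if K = K'[k := a] then ?t k else 0 else 0)
           = (if I = I' then ?t k else 0)" for I
          using X[OF False] by (auto simp: sum.delta)
        then show ?thesis using X[OF False] by (simp add: sum.delta)
      qed
    qed
    also have "\<dots> = ?R"
      unfolding super_deriv_def sum_distrib_left sum_negf[symmetric] by (intro sum.cong) auto
    finally show ?thesis .
  qed
  show ?thesis
    unfolding gl_basis_def distrib_left[where 'a = 'a] sum.distrib first second gl_op_def by simp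
qed

lemma gl_act_eq:
  assumes X: "\<And>I K. X I K \<noteq> 0 \<Longrightarrow> I \<in> seqs n m p \<and> K \<in> seqs n m q"
  shows "gl_act n m p q A X I' K' = (\<Sum>a\<in>RV n m. \<Sum>b\<in>RV n m. A a b * gl_op a b X I' K')"
proof -
  have "gl_act n m p q A X I' K' = (\<Sum>I\<in>seqs n m p. \<Sum>K\<in>seqs n m q. \<Sum>a\<in>RV n m. \<Sum>b\<in>RV n m.
      A a b * (X I K * gl_basis a b I K I' K'))"
    unfolding gl_act_def sum_distrib_left by (simp add: mult_ac)
  also have "\<dots> = (\<Sum>a\<in>RV n m. \<Sum>b\<in>RV n m. \<Sum>I\<in>seqs n m p. \<Sum>K\<in>seqs n m q.
      A a b * (X I K * gl_basis a b I K I' K'))"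
    by (simp only: sum.swap[of _ "RV n m" "seqs n m _"])
  also have "\<dots> = (\<Sum>a\<in>RV n m. \<Sum>b\<in>RV n m. A a b * gl_op a b X I' K')"
    unfolding sum_distrib_left[symmetric]
    by (intro sum.cong refl arg_cong2[where f = "(*)"] sum_gl_basis) (rule X)
  finally show ?thesis .
qed

section \<open>Commutation relations of the odd generators\<close>

lemma sign_take_update:
  assumes "k < length J" "par (J ! k) + par b = 1"
  shows "(-1 :: 'a::field) ^ psum (take l (J[k := b]))
     = (if k < l then -1 else 1) * (-1) ^ psum (take l J)"
proof (cases "k < l")
  case True
  have *: "take l J = take k J @ J ! k # drop (Suc k) (take l J)"
    using id_take_nth_drop[of k "take l J"] True assms by (simp add: min_def)
  have **: "take l (J[k := b]) = take k J @ b # drop (Suc k) (take l J)"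
    using True assms upd_conv_take_nth_drop[of k "take l J" b]
    by (simp add: take_update_swap min_def)
  have "par (J ! k) = 0 \<and> par b = 1 \<or> par (J ! k) = 1 \<and> par b = 0" using assms(2) by linarith
  moreover have "psum (take l J) = psum (take k J) + par (J ! k) + psum (drop (Suc k) (take l J))"
    by (subst *) (simp add: psum_def)
  moreover have "psum (take l (J[k := b])) = psum (take k J) + par b + psum (drop (Suc k) (take l J))"
    by (subst **) (simp add: psum_def)
  ultimately show ?thesis using True by (auto simp: power_add)
qed auto

text \<open>The cross terms at two different positions cancel; the terms at a single position give
  the even generators.\<close>

lemma super_deriv_anticommutator:
  assumes "par a = par d" "par b = par c" "par a + par b = 1"
  shows "super_deriv a b (super_deriv c d g) J + super_deriv c d (super_deriv a b g) J
     = (if b = c then super_deriv a d g J else 0) + (if a = d then super_deriv c b g J else 0)"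
proof -
  let ?e = "\<lambda>k. (-1 :: 'a) ^ psum (take k J)"
  let ?F = "\<lambda>k l. if k \<noteq> l \<and> J ! k = a \<and> J ! l = c then (if k < l then -1 else 1) * ?e k * ?e l * g (J[k := b, l := d]) else 0"
  have pm: "par a + par b = 1" "par c + par d = 1" using assms by simp_all
  have ee: "?e k * ?e k = 1" for k by (rule sign_power_sq)
  have ee': "?e k * (?e k * z) = z" for k z using ee[of k] by (simp add: mult.assoc[symmetric])
  have one: "super_deriv a b (super_deriv c d g) J =
     (\<Sum>k<length J. \<Sum>l<length J. ?F k l) + (if b = c then super_deriv a d g J else 0)"
  proof -
    have "super_deriv a b (super_deriv c d g) J = (\<Sum>k<length J. \<Sum>l<length J. ?F k l +
       (if l = k then if b = c \<and> J ! k = a then g (J[k := d]) else 0 else 0))"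
      unfolding super_deriv_def
    proof (intro sum.cong refl, goal_cases)
      case (1 k)
      show ?case
      proof (cases "J ! k = a")
        case True
        have "?e k * ((if (J[k := b]) ! l = c then (-1) ^ psum (take l (J[k := b])) * g (J[k := b, l := d]) else 0))
           = ?F k l + (if l = k then if b = c \<and> J ! k = a then g (J[k := d]) else 0 else 0)"
          if "l < length J" for l
        proof (cases "l = k")
          case True
          then show ?thesis using 1 \<open>J ! k = a\<close> by (simp add: ee')
        next
          case False
          have "(-1 :: 'a) ^ psum (take l (J[k := b])) = (if k < l then -1 else 1) * ?e l"
            by (rule sign_take_update) (use 1 \<open>J ! k = a\<close> assms(3) in simp_all)
          then show ?thesis using False that \<open>J ! k = a\<close> by simp
        qed
        then show ?thesis unfolding if_P[OF True] pm mult_1 length_list_update sum_distrib_left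
          by (intro sum.cong refl) auto
      next
        case False
        then show ?thesis by simp
      qed
    qed
    also have "\<dots> = (\<Sum>k<length J. \<Sum>l<length J. ?F k l) +
        (\<Sum>k<length J. if b = c \<and> J ! k = a then g (J[k := d]) else 0)"
      unfolding sum.distrib by simp
    \<comment> \<open>At a single position the two odd prefix signs have squared to 1, and
      \<open>super_deriv a d\<close> carries no sign because \<open>a\<close> and \<open>d\<close>
      have equal parity.\<close>
    also have "(\<Sum>k<length J. if b = c \<and> J ! k = a then g (J[k := d]) else 0)
       = (if b = c then super_deriv a d g J else 0)"
      using assms by (auto simp: super_deriv_def mult_2[symmetric] power_mult simp del: mult_2 intro!: sum.cong)
    finally show ?thesis .
  qed
  have two: "super_deriv c d (super_deriv a b g) J =
     (\<Sum>l<length J. \<Sum>k<length J. - ?F k l) + (if a = d then super_deriv c b g J else 0)"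
  proof -
    have "super_deriv c d (super_deriv a b g) J = (\<Sum>l<length J. \<Sum>k<length J. - ?F k l +
       (if k = l then if a = d \<and> J ! l = c then g (J[l := b]) else 0 else 0))"
      unfolding super_deriv_def
    proof (intro sum.cong refl, goal_cases)
      case (1 l)
      show ?case
      proof (cases "J ! l = c")
        case True
        have "?e l * ((if (J[l := d]) ! k = a then (-1) ^ psum (take k (J[l := d])) * g (J[l := d, k := b]) else 0))
           = - ?F k l + (if k = l then if a = d \<and> J ! l = c then g (J[l := b]) else 0 else 0)"
          if "k < length J" for k
        proof (cases "k = l")
          case True
          then show ?thesis using 1 \<open>J ! l = c\<close> by (simp add: ee')
        next
          case False
          have "(-1 :: 'a) ^ psum (take k (J[l := d])) = (if l < k then -1 else 1) * ?e k"
            by (rule sign_take_update) (use 1 \<open>J ! l = c\<close> assms in simp_all)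
          moreover have "J[l := d, k := b] = J[k := b, l := d]" using False by (metis list_update_swap)
          ultimately show ?thesis using False that \<open>J ! l = c\<close> by (simp add: mult.left_commute)
        qed
        then show ?thesis unfolding if_P[OF True] pm mult_1 length_list_update sum_distrib_left
          by (intro sum.cong refl) auto
      next
        case False
        then show ?thesis by simp
      qed
    qed
    also have "\<dots> = (\<Sum>l<length J. \<Sum>k<length J. - ?F k l) +
        (\<Sum>l<length J. if a = d \<and> J ! l = c then g (J[l := b]) else 0)"
      unfolding sum.distrib by simp
    also have "(\<Sum>l<length J. if a = d \<and> J ! l = c then g (J[l := b]) else 0)
       = (if a = d then super_deriv c b g J else 0)"
      using assms by (auto simp: super_deriv_def mult_2[symmetric] power_mult simp del: mult_2 intro!: sum.cong)
    finally show ?thesis .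
  qed
  have "(\<Sum>l<length J. \<Sum>k<length J. - ?F k l) = - (\<Sum>k<length J. \<Sum>l<length J. ?F k l)"
    unfolding sum_negf by (subst sum.swap) simp
  then show ?thesis unfolding one two by simp
qed

text \<open>An odd operator reads \<open>f\<close> at words of the opposite parity, which flips the
  sign depending on \<open>psum\<close>.\<close>

lemma super_deriv_sign_twist:
  assumes "par a + par b = 1"
  shows "super_deriv a b (\<lambda>I. (-1) ^ (p + psum I) * f I) J
       = - ((-1) ^ (p + psum J) * super_deriv a b f J)"
proof -
  have *: "(-1 :: 'a) ^ psum (J[k := b]) = - ((-1) ^ psum J)" if "k < length J" "J ! k = a" for k
    using sign_take_update[of k J b "length J", where 'a = 'a] that assms by simp
  show ?thesis
    unfolding super_deriv_def sum_distrib_left sum_negf[symmetric]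
  proof (intro sum.cong refl, goal_cases)
    case (1 k)
    then show ?case using * by (cases "J ! k = a") (simp_all add: power_add mult_ac)
  qed
qed

text \<open>Each operator counts only letters of its own word, so operators on different factors
  commute without sign; the sign between the factors is kept in \<open>gl_op\<close>.\<close>

lemma super_deriv_swap:
  "super_deriv a b (\<lambda>K. super_deriv c d (\<lambda>I. X I K) I) K
     = super_deriv c d (\<lambda>I. super_deriv a b (\<lambda>K. X I K) K) I"
proof -
  have "super_deriv a b (\<lambda>K. super_deriv c d (\<lambda>I. X I K) I) K
      = (\<Sum>k<length K. \<Sum>l<length I. if K ! k = a \<and> I ! l = c then
          (-1) ^ ((par a + par b) * psum (take k K)) * (-1) ^ ((par c + par d) * psum (take l I))
            * X (I[l := d]) (K[k := b]) else 0)"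
    unfolding super_deriv_def by (intro sum.cong refl) (auto simp: sum_distrib_left intro!: sum.cong)
  also have "\<dots> = (\<Sum>l<length I. \<Sum>k<length K. if K ! k = a \<and> I ! l = c then
          (-1) ^ ((par a + par b) * psum (take k K)) * (-1) ^ ((par c + par d) * psum (take l I))
            * X (I[l := d]) (K[k := b]) else 0)"
    by (rule sum.swap)
  also have "\<dots> = super_deriv c d (\<lambda>I. super_deriv a b (\<lambda>K. X I K) K) I"
    unfolding super_deriv_def
    by (intro sum.cong refl) (auto simp: sum_distrib_left mult_ac intro!: sum.cong)
  finally show ?thesis .
qed

lemma gl_op_odd:
  assumes "par a + par b = 1"
  shows "gl_op a b X I K = super_deriv a b (\<lambda>I. X I K) I
     - (-1) ^ (par a + psum I) * super_deriv b a (X I) K"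
  by (simp add: gl_op_def assms)

lemma gl_op_even:
  assumes "par a = par b"
  shows "gl_op a b X I K = super_deriv a b (\<lambda>I. X I K) I - super_deriv b a (X I) K"
  using assms par_cases[of b] by (auto simp: gl_op_def power_add distrib_left power_mult_distrib[symmetric] mult_2[symmetric] power_mult)

text \<open>The two mixed terms are arranged so that they cancel against those of the opposite
  composition, leaving the anticommutators on the separate factors.\<close>

lemma gl_op_comp_odd:
  assumes ab: "par a + par b = 1" and cd: "par c + par d = 1"
  shows "gl_op a b (gl_op c d X) I K = super_deriv a b (super_deriv c d (\<lambda>I. X I K)) I
     + (-1) ^ (par c + psum I) * super_deriv a b (\<lambda>I. super_deriv d c (X I) K) I
     - (-1) ^ (par a + psum I) * super_deriv c d (\<lambda>I. super_deriv b a (X I) K) I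
     + (-1) ^ (par a + par c) * super_deriv b a (super_deriv d c (X I)) K"
proof -
  have s: "(-1) ^ (par a + psum I) * ((-1) ^ (par c + psum I) * z) = (-1) ^ (par a + par c) * (z :: 'a)" for z
    using sign_power_sq[of "psum I", where 'a = 'a]
    by (simp add: power_add mult_ac)
  have "gl_op a b (gl_op c d X) I K
     = super_deriv a b (super_deriv c d (\<lambda>I. X I K)) I
       + (-1) ^ (par c + psum I) * super_deriv a b (\<lambda>I. super_deriv d c (X I) K) I
       - (-1) ^ (par a + psum I) * (super_deriv b a (\<lambda>K. super_deriv c d (\<lambda>I. X I K) I) K
          - (-1) ^ (par c + psum I) * super_deriv b a (super_deriv d c (X I)) K)"
    unfolding gl_op_odd[OF ab] gl_op_odd[OF cd, abs_def] super_deriv_diff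
    by (simp add: super_deriv_sign_twist[OF ab] super_deriv_scale)
  then show ?thesis
    using super_deriv_swap[of b a c d X I K] by (simp add: algebra_simps s)
qed

lemma gl_op_anticommutator:
  "gl_op (Ev r) (Od j') (gl_op (Od j) (Ev i) X) I K + gl_op (Od j) (Ev i) (gl_op (Ev r) (Od j') X) I K
    = (if j = j' then gl_op (Ev r) (Ev i) X I K else 0) + (if r = i then gl_op (Od j) (Od j') X I K else 0)"
  using super_deriv_anticommutator[of "Ev r" "Ev i" "Od j'" "Od j" "\<lambda>I. X I K" I]
    super_deriv_anticommutator[of "Od j'" "Od j" "Ev r" "Ev i" "X I" K]
  by (simp add: gl_op_comp_odd gl_op_even algebra_simps split: if_splits)

section \<open>Row-symmetric tensors killed by the lowering operators\<close>

text \<open>Moving \<open>Od j\<close> from \<open>x\<close> to \<open>k\<close> costs the sign of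
  the odd letters in between, which is the quotient of the two prefix signs. Hence all positions of
  one row contribute equally to the lowering operator.\<close>

lemma row_swap_sign:
  fixes f :: "idx list \<Rightarrow> 'a::field"
  assumes x: "x < length I" and k: "k < length I" and Ix: "I ! x = Od j"
    and I': "I' = I[x := Ev r]" and I'k: "I' ! k = Ev r"
    and sym: "permact (transpose x k) f I = f I"
  shows "(-1) ^ psum (take k I') * f (I'[k := Od j]) = (-1) ^ psum (take x I') * f I"
proof (cases "k = x")
  case True
  then show ?thesis using assms by (metis list_update_id list_update_overwrite)
next
  case False
  let ?\<pi> = "transpose x k"
  have \<pi>: "?\<pi> permutes {..<length I}" using x k by (intro permutes_swap_id) auto
  have Ik: "I ! k = Ev r" using False I'k I' by simp
  have eq: "permute_list ?\<pi> I = I'[k := Od j]"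
    by (rule nth_equalityI)
      (use \<pi> x k Ix Ik I' in \<open>auto simp: permute_list_nth nth_list_update transpose_def\<close>)
  have o: "odds (I'[k := Od j]) = insert k (odds I')"
    using k I' by (auto simp: odds_def nth_list_update)
  have n: "x \<notin> odds I'" "k \<notin> odds I'" using x k I' I'k by (auto simp: odds_def)
  have "koszul (odds (I'[k := Od j])) ?\<pi> = (-1) ^ psum (take k I') * (-1 :: 'a) ^ psum (take x I')"
    unfolding o sign_power_psum prod.distrib[symmetric]
    by (rule koszul_transpose_one) (use n in auto)
  then have "f I = (-1) ^ psum (take k I') * (-1) ^ psum (take x I') * f (I'[k := Od j])"
    using sym unfolding permact_koszul[OF \<pi>] eq by simp
  then have "(-1) ^ psum (take x I') * f I
     = ((-1) ^ psum (take x I') * (-1) ^ psum (take x I')) * ((-1) ^ psum (take k I') * f (I'[k := Od j]))"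
    by (simp only: mult_ac)
  then show ?thesis by (simp only: sign_power_sq mult_1)
qed

lemma psum_update:
  assumes "x < length I"
  shows "psum (I[x := c]) + par (I ! x) = psum I + par c"
proof -
  have "psum I = psum (take x I) + par (I ! x) + psum (drop (Suc x) I)"
    by (subst id_take_nth_drop[OF assms]) (simp add: psum_def)
  moreover have "psum (I[x := c]) = psum (take x I) + par c + psum (drop (Suc x) I)"
    using assms by (simp add: upd_conv_take_nth_drop psum_def)
  ultimately show ?thesis by simp
qed

lemma psum_nonzero:
  assumes "psum I \<noteq> 0"
  obtains x where "x < length I" "par (I ! x) = 1"
proof -
  obtain c where "c \<in> set I" "par c \<noteq> 0"
    using assms by (auto simp: psum_def)
  then show ?thesis using that par_cases by (metis in_set_conv_nth)
qed

text \<open>Replacing an odd letter \<open>Od j\<close> of \<open>I\<close> in row \<open>r\<close> by \<open>Ev r\<close> and applying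
  \<open>E (Ev r) (Od j)\<close> gives back a positive multiple of \<open>Y I K\<close>, up to values of \<open>Y\<close> where \<open>I\<close>
  has fewer odd letters or more letters \<open>Ev r\<close> in their own row \<open>r\<close>.\<close>

lemma lowering_vanish:
  fixes Y :: "idx list \<Rightarrow> idx list \<Rightarrow> 'a::field_char_0"
  assumes n: "n > 0"
    and supp: "\<And>I K. Y I K \<noteq> 0 \<Longrightarrow> length I = p \<Longrightarrow> length K = q \<Longrightarrow> set I \<subseteq> RV n m"
    and row: "\<And>I K x y. length I = p \<Longrightarrow> length K = q \<Longrightarrow> x < p \<Longrightarrow> y < p \<Longrightarrow> x mod n = y mod n
        \<Longrightarrow> permact (transpose x y) (\<lambda>I. Y I K) I = Y I K"
    and base: "\<And>I K. length I = p \<Longrightarrow> length K = q \<Longrightarrow> psum I = 0 \<Longrightarrow> Y I K = 0"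
    and low: "\<And>I K r j. length I = p \<Longrightarrow> length K = q \<Longrightarrow> r \<in> {1..n} \<Longrightarrow> j \<in> {1..m}
        \<Longrightarrow> gl_op (Ev r) (Od j) Y I K = 0"
    and "length I = p" "length K = q"
  shows "Y I K = 0"
proof -
  \<comment> \<open>Position \<open>k\<close> lies in row \<open>k mod n\<close> of the tableau
    \<open>s\<close>; rows count from 0 and letters from 1, so \<open>d\<close> counts the even
    letters standing in their own row.\<close>
  define d where "d I = card {k. k < p \<and> I ! k = Ev (Suc (k mod n))}" for I :: "idx list"
  \<comment> \<open>Since \<open>p - d I\<close> is at most \<open>p\<close>, this number encodes
    the lexicographic order: fewer odd letters first, then more letters in their own row.\<close>
  define \<mu> where "\<mu> I = psum I * Suc p + (p - d I)" for I
  have d_le: "d I \<le> p" for I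
    using card_mono[of "{..<p}" "{k. k < p \<and> I ! k = Ev (Suc (k mod n))}"] by (auto simp: d_def)
  have \<mu>1: "\<mu> I' < \<mu> I" if "psum I = Suc (psum I')" for I I'
    using that by (simp add: \<mu>_def)
  have \<mu>2: "\<mu> I' < \<mu> I" if "psum I = psum I'" "d I < d I'" for I I'
    using that d_le[of I'] by (simp add: \<mu>_def)
  show ?thesis
    using assms(6,7)
  proof (induction "\<mu> I" arbitrary: I K rule: less_induct)
    case less
    note I = \<open>length I = p\<close> and K = \<open>length K = q\<close>
    show ?case
    proof (rule ccontr)
      assume Y: "Y I K \<noteq> 0"
      then have "psum I \<noteq> 0" using base I K by blast
      then obtain x where x: "x < p" "par (I ! x) = 1" using psum_nonzero I by metis
      have "I ! x \<in> RV n m" using supp[OF Y I K] x I by (meson nth_mem subsetD)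
      then obtain j where j: "I ! x = Od j" "j \<in> {1..m}" using x by (auto simp: RV_def)
      define r where "r = Suc (x mod n)"
      have r: "r \<in> {1..n}" using n by (auto simp: r_def Suc_le_eq)
      define I' where "I' = I[x := Ev r]"
      have I': "length I' = p" by (simp add: I'_def I)
      have psI': "psum I = Suc (psum I')"
        using psum_update[of x I "Ev r"] x I j by (simp add: I'_def)
      have "Y I' K' = 0" if "length K' = q" for K'
        using less.hyps[OF \<mu>1[OF psI'] I' that] .
      \<comment> \<open>The part of the operator acting on the dual factor leaves \<open>I'\<close>
        fixed, and \<open>I'\<close> has one odd letter fewer than \<open>I\<close>.\<close>
      then have W: "super_deriv (Od j) (Ev r) (Y I') K = 0"
        by (simp add: super_deriv_def K cong: if_cong)
      define S where "S = {k. k < p \<and> I' ! k = Ev r \<and> k mod n = x mod n}"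
      have finS: "finite S" by (simp add: S_def)
      have "0 = gl_op (Ev r) (Od j) Y I' K" using low[OF I' K r j(2)] by simp
      also have "\<dots> = super_deriv (Ev r) (Od j) (\<lambda>I. Y I K) I'"
        by (simp add: gl_op_def W)
      also have "\<dots> = (\<Sum>k<p. if k \<in> S then (-1) ^ psum (take x I') * Y I K else 0)"
        unfolding super_deriv_def I'
      proof (intro sum.cong refl, goal_cases)
        case (1 k)
        then have k: "k < p" by simp
        consider "I' ! k \<noteq> Ev r" | "k \<in> S" | "I' ! k = Ev r" "k mod n \<noteq> x mod n"
          using k by (auto simp: S_def)
        then show ?case
        proof cases
          case 1
          then show ?thesis by (simp add: S_def)
        next
          case 2
          then have "I' ! k = Ev r" "x mod n = k mod n" by (auto simp: S_def)
          then show ?thesis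
            using 2 row_swap_sign[of x I k j I' r "\<lambda>I. Y I K"] x k I j row[OF I K x(1) k]
            by (simp add: I'_def)
        next
          case 3
          \<comment> \<open>Here \<open>Ev r\<close> stands outside its own row. Making it odd
            restores the number of odd letters, loses no letter counted by \<open>d\<close> and
            gains the one at \<open>x\<close>, so the measure drops.\<close>
          have kx: "k \<noteq> x" using 3 by auto
          let ?I = "I'[k := Od j]"
          have ps: "psum I = psum ?I"
            using psum_update[of k I' "Od j"] 3 k I' psI' by simp
          have "{l. l < p \<and> I ! l = Ev (Suc (l mod n))} \<subset> {l. l < p \<and> ?I ! l = Ev (Suc (l mod n))}"
          proof (rule psubsetI)
            show "{l. l < p \<and> I ! l = Ev (Suc (l mod n))} \<subseteq> {l. l < p \<and> ?I ! l = Ev (Suc (l mod n))}"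
              using 3 kx k I I' x j by (auto simp: I'_def nth_list_update r_def)
            have "x \<in> {l. l < p \<and> ?I ! l = Ev (Suc (l mod n))}"
              using kx x I by (simp add: I'_def r_def)
            moreover have "x \<notin> {l. l < p \<and> I ! l = Ev (Suc (l mod n))}" using j by simp
            ultimately show "{l. l < p \<and> I ! l = Ev (Suc (l mod n))} \<noteq> {l. l < p \<and> ?I ! l = Ev (Suc (l mod n))}"
              by blast
          qed
          then have "d I < d ?I" unfolding d_def by (intro psubset_card_mono) auto
          then have "Y ?I K = 0" using less.hyps[OF \<mu>2[OF ps]] I' K by simp
          then show ?thesis using 3 by (simp add: S_def)
        qed
      qed
      also have "\<dots> = of_nat (card S) * ((-1) ^ psum (take x I') * Y I K)"
      proof -
        have "{..<p} \<inter> S = S" by (auto simp: S_def)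
        then show ?thesis by (simp add: sum.If_cases)
      qed
      \<comment> \<open>In characteristic 0 the multiplicity \<open>card S\<close> would have to be
        0, but \<open>S\<close> contains \<open>x\<close>.\<close>
      finally have "card S = 0" using Y by simp
      moreover have "x \<in> S" using x I by (simp add: S_def I'_def)
      ultimately show False using finS by auto
    qed
  qed
qed

text \<open>The first part of \<open>gl_op\<close> commutes with permutations of \<open>I\<close>;
  the second is linear in the coefficients and depends on \<open>I\<close> otherwise only through
  \<open>psum I\<close>, which permutations preserve.\<close>

lemma gl_op_permact_left:
  assumes \<pi>: "\<pi> permutes {..<length I}"
    and X: "\<And>I' K'. length I' = length I \<Longrightarrow> length K' = length K \<Longrightarrow>
        permact \<pi> (\<lambda>I. X I K') I' = X I' K'"
  shows "permact \<pi> (\<lambda>I. gl_op a b X I K) I = gl_op a b X I K"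
proof -
  let ?I = "permute_list \<pi> I" and ?k = "koszul (odds (permute_list \<pi> I)) \<pi>"
  have "permact \<pi> (super_deriv a b (\<lambda>I. X I K)) I = super_deriv a b (\<lambda>I. X I K) I"
    unfolding permact_super_deriv[OF \<pi>] by (rule super_deriv_cong) (simp add: X)
  then have 1: "?k * super_deriv a b (\<lambda>I. X I K) ?I = super_deriv a b (\<lambda>I. X I K) I"
    unfolding permact_koszul[OF \<pi>] .
  have "?k * super_deriv b a (X ?I) K = super_deriv b a (\<lambda>K. ?k * X ?I K) K"
    by (simp add: super_deriv_scale)
  also have "\<dots> = super_deriv b a (X I) K"
    by (rule super_deriv_cong) (use X[of I] in \<open>simp add: permact_koszul[OF \<pi>]\<close>)
  finally have 2: "?k * super_deriv b a (X ?I) K = super_deriv b a (X I) K" .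
  have "psum ?I = psum I" by (rule psum_mset) (simp add: \<pi>)
  then show ?thesis
    unfolding permact_koszul[OF \<pi>] gl_op_def right_diff_distrib 1
    by (simp add: mult.left_commute[of ?k] 2)
qed

lemma gl_op_permact_right:
  assumes \<pi>: "\<pi> permutes {..<length K}"
    and X: "\<And>I' K'. length I' = length I \<Longrightarrow> length K' = length K \<Longrightarrow>
        permact \<pi> (X I') K' = - X I' K'"
  shows "permact \<pi> (gl_op a b X I) K = - gl_op a b X I K"
proof -
  let ?K = "permute_list \<pi> K" and ?k = "koszul (odds (permute_list \<pi> K)) \<pi>"
  have neg: "super_deriv a b (\<lambda>I. - f I) J = - super_deriv a b f J" for a b J and f :: "idx list \<Rightarrow> 'a"
    using super_deriv_scale[of a b "-1" f J] by simp
  have "permact \<pi> (super_deriv b a (X I)) K = super_deriv b a (\<lambda>K. - X I K) K"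
    unfolding permact_super_deriv[OF \<pi>] by (rule super_deriv_cong) (simp add: X)
  then have 1: "?k * super_deriv b a (X I) ?K = - super_deriv b a (X I) K"
    unfolding permact_koszul[OF \<pi>] neg .
  have "?k * super_deriv a b (\<lambda>I. X I ?K) I = super_deriv a b (\<lambda>I. ?k * X I ?K) I"
    by (simp add: super_deriv_scale)
  also have "\<dots> = super_deriv a b (\<lambda>I. - X I K) I"
    by (rule super_deriv_cong) (use X[of _ K] in \<open>simp add: permact_koszul[OF \<pi>]\<close>)
  finally have 2: "?k * super_deriv a b (\<lambda>I. X I ?K) I = - super_deriv a b (\<lambda>I. X I K) I"
    unfolding neg .
  show ?thesis
    unfolding permact_koszul[OF \<pi>] gl_op_def right_diff_distrib 2
    by (simp add: mult.left_commute[of ?k] 1)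
qed

lemma super_deriv_nonzero:
  assumes "super_deriv a b f J \<noteq> 0"
  obtains k where "k < length J" "J ! k = a" "f (J[k := b]) \<noteq> 0"
proof -
  have "\<exists>k<length J. J ! k = a \<and> f (J[k := b]) \<noteq> 0"
  proof (rule ccontr)
    assume "\<not> ?thesis"
    then have "super_deriv a b f J = 0"
      unfolding super_deriv_def by (intro sum.neutral) auto
    then show False using assms by simp
  qed
  then show ?thesis using that by blast
qed

lemma sum_lessThan_add:
  fixes f :: "nat \<Rightarrow> 'a::comm_monoid_add"
  shows "(\<Sum>k<a + b. f k) = (\<Sum>k<a. f k) + (\<Sum>k<b. f (a + k))"
  by (induction b) (simp_all add: add.assoc)

section \<open>Invariance of the contraction tensor\<close>

text \<open>The super Leibniz rule: the prefix of a position in \<open>B\<close> contains all of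
  \<open>A\<close>.\<close>

lemma super_deriv_append:
  "super_deriv a b f (A @ B) = super_deriv a b (\<lambda>A. f (A @ B)) A
     + (-1) ^ ((par a + par b) * psum A) * super_deriv a b (\<lambda>B. f (A @ B)) B"
proof -
  have "super_deriv a b f (A @ B) = (\<Sum>k<length A. if A ! k = a
      then (-1) ^ ((par a + par b) * psum (take k A)) * f (A[k := b] @ B) else 0)
    + (\<Sum>k<length B. if B ! k = a
      then (-1) ^ ((par a + par b) * psum (A @ take k B)) * f (A @ B[k := b]) else 0)"
    unfolding super_deriv_def length_append sum_lessThan_add
    by (intro arg_cong2[where f = "(+)"] sum.cong refl) (simp_all add: nth_append list_update_append)
  also have "(\<Sum>k<length B. if B ! k = a
      then (-1) ^ ((par a + par b) * psum (A @ take k B)) * f (A @ B[k := b]) else 0)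
    = (-1) ^ ((par a + par b) * psum A) * super_deriv a b (\<lambda>B. f (A @ B)) B"
    unfolding super_deriv_def sum_distrib_left
    by (intro sum.cong refl) (simp add: psum_def distrib_left power_add mult.assoc)
  finally show ?thesis unfolding super_deriv_def .
qed

text \<open>A matrix unit and its transpose: the operator moves from the coefficient index to the
  label of the basis tensor, where it can be split along the factors of the label.\<close>

lemma super_deriv_basis:
  "super_deriv a b (basis_v P) J = super_deriv b a (\<lambda>P. basis_v P J) P"
proof (cases "length P = length J")
  case True
  show ?thesis
    unfolding super_deriv_def True
  proof (intro sum.cong refl, goal_cases)
    case (1 k)
    have *: "(J ! k = a \<and> J[k := b] = P) = (P ! k = b \<and> J = P[k := a])"
      using list_update_iff[of k P b J a] 1 True by (simp add: eq_commute[of P])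
    show ?case
    proof (cases "P ! k = b \<and> J = P[k := a]")
      case True
      then have "J ! k = a" "J[k := b] = P" "P ! k = b" "P[k := a] = J" using * by simp_all
      moreover have "take k J = take k P" using True by simp
      ultimately show ?thesis by (simp add: basis_v_def add.commute)
    next
      case False
      then have "J ! k = a \<Longrightarrow> J[k := b] \<noteq> P" "P ! k = b \<Longrightarrow> J \<noteq> P[k := a]" using * by blast+
      then show ?thesis by (cases "J ! k = a"; cases "P ! k = b") (simp_all add: basis_v_def)
    qed
  qed
next
  case False
  then have "J[k := b] \<noteq> P" "J \<noteq> P[k := a]" for k by auto
  then show ?thesis by (simp add: super_deriv_def basis_v_def cong: if_cong)
qed

section \<open>Linearity of the symmetrizers and transfer of operators to labels\<close>

lemma young_e_sum: "young_e T r c (\<lambda>I. \<Sum>x\<in>A. f x I) J = (\<Sum>x\<in>A. young_e T r c (f x) J)"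
proof -
  have "young_e T r c (\<lambda>I. \<Sum>x\<in>A. f x I) J = (\<Sum>\<tau>\<in>colgrp T r c. \<Sum>\<sigma>\<in>rowgrp T r c. \<Sum>x\<in>A.
      of_int (sign \<tau>) * permact \<sigma> (permact \<tau> (f x)) J)"
    unfolding young_e_def permact_sum[abs_def] sum_distrib_left by (rule refl)
  then show ?thesis
    unfolding young_e_def
    by (simp only: sum.swap[of _ A "rowgrp T r c"] sum.swap[of _ A "colgrp T r c"])
qed

lemma young_e'_sum: "young_e' T r c (\<lambda>I. \<Sum>x\<in>A. f x I) J = (\<Sum>x\<in>A. young_e' T r c (f x) J)"
proof -
  have "young_e' T r c (\<lambda>I. \<Sum>x\<in>A. f x I) J = (\<Sum>\<tau>\<in>colgrp T r c. \<Sum>\<sigma>\<in>rowgrp T r c. \<Sum>x\<in>A.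
      of_int (sign \<tau>) * permact \<tau> (permact \<sigma> (f x)) J)"
    unfolding young_e'_def permact_sum[abs_def] sum_distrib_left by (rule refl)
  then show ?thesis
    unfolding young_e'_def
    by (simp only: sum.swap[of _ A "rowgrp T r c"] sum.swap[of _ A "colgrp T r c"])
qed

lemma young_e_scale: "young_e T r c (\<lambda>I. z * f I) J = z * young_e T r c f J"
  unfolding young_e_def permact_scale[abs_def] sum_distrib_left by (simp only: mult.left_commute)

lemma young_e'_scale: "young_e' T r c (\<lambda>I. z * f I) J = z * young_e' T r c f J"
  unfolding young_e'_def permact_scale[abs_def] sum_distrib_left by (simp only: mult.left_commute)

lemma linear_super_deriv:
  fixes U :: "(idx list \<Rightarrow> 'a::field) \<Rightarrow> 'a"
  assumes sum: "\<And>A f. U (\<lambda>I. \<Sum>x\<in>A. f x I) = (\<Sum>x\<in>(A :: nat set). U (f x))"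
    and scale: "\<And>z f. U (\<lambda>I. z * f I) = z * U f"
  shows "U (\<lambda>J. super_deriv b a (\<lambda>P. F P J) P) = super_deriv b a (\<lambda>P. U (F P)) P"
proof -
  let ?c = "\<lambda>k. if P ! k = b then (-1) ^ ((par b + par a) * psum (take k P)) else 0 :: 'a"
  have *: "super_deriv b a f P = (\<Sum>k<length P. ?c k * f (P[k := a]))" for f
    unfolding super_deriv_def by (intro sum.cong refl) auto
  show ?thesis unfolding * sum scale ..
qed

lemma super_deriv_young_e_basis:
  assumes "length J = r * c"
  shows "super_deriv a b (young_e T r c (basis_v P)) J = super_deriv b a (\<lambda>P. young_e T r c (basis_v P) J) P"
  using linear_super_deriv[of "\<lambda>X. young_e T r c X J" b a basis_v P, OF young_e_sum young_e_scale]
  unfolding young_e_super_deriv[OF assms, symmetric] super_deriv_basis[abs_def] by simp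

lemma super_deriv_young_e'_basis:
  assumes "length J = r * c"
  shows "super_deriv a b (young_e' T r c (basis_v P)) J = super_deriv b a (\<lambda>P. young_e' T r c (basis_v P) J) P"
  using linear_super_deriv[of "\<lambda>X. young_e' T r c X J" b a basis_v P, OF young_e'_sum young_e'_scale]
  unfolding young_e'_super_deriv[OF assms, symmetric] super_deriv_basis[abs_def] by simp

text \<open>The exponent counts pairs of odd letters, so only their number matters.\<close>

lemma alpha_choose: "alpha L = psum L choose 2"
proof (induction L rule: rev_induct)
  case (snoc x L)
  have "(\<Sum>i<length L. par (L ! i)) = psum L"
    unfolding psum_def by (simp add: sum_list_sum_nth atLeast0LessThan)
  then have "alpha (L @ [x]) = alpha L + psum L * par x"
    by (simp add: alpha_def nth_append sum_distrib_right[symmetric] cong: sum.cong_simp)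
  then show ?case using snoc par_cases[of x]
    by (auto simp: psum_def numeral_2_eq_2)
qed (simp add: alpha_def psum_def)

text \<open>Making a letter odd creates one new pair with each odd letter already present. This
  matches the sign of passing the operator over the first factor, and explains the coefficients of
  \<open>\<theta>\<close>.\<close>

lemma sign_alpha_update:
  assumes "k < length L" "L ! k = b"
  shows "(-1 :: 'a::field) ^ alpha L = (-1) ^ (alpha (L[k := a]) + (par a + par b) * (par a + psum (L[k := a])))"
proof -
  have ps: "psum (L[k := a]) + par b = psum L + par a"
    using psum_update[of k L a] assms by simp
  have ch: "Suc s choose 2 = s + (s choose 2)" for s by (simp add: numeral_2_eq_2)
  consider "par a = par b" | "par a = 1" "par b = 0" | "par a = 0" "par b = 1"
    using par_cases[of a] par_cases[of b] by auto
  then show ?thesis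
  proof cases
    case 1
    then have "psum (L[k := a]) = psum L" using ps by simp
    then show ?thesis using 1 by (simp add: alpha_choose power_add mult_2[symmetric] power_mult)
  next
    case 2
    then have "psum (L[k := a]) = Suc (psum L)" using ps by simp
    then show ?thesis using 2 by (simp add: alpha_choose ch power_add sign_power_sq mult_ac)
  next
    case 3
    then have "psum L = Suc (psum (L[k := a]))" using ps by simp
    then show ?thesis using 3 by (simp add: alpha_choose ch power_add)
  qed
qed

text \<open>Invariance of \<open>\<theta>\<^sub>N = \<Sum>\<^sub>L (-1)\<^bsup>\<alpha>(L,L)\<^esup> v\<^sub>L \<otimes> v\<^sup>*\<^sub>L\<close>, tested against arbitrary
  functionals \<open>f\<close>, \<open>g\<close> on the two factors.\<close>

lemma theta_invariant:
  fixes f g :: "idx list \<Rightarrow> 'a::field"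
  assumes ab: "a \<in> RV n m" "b \<in> RV n m"
  shows "(\<Sum>L\<in>seqs n m N. (-1) ^ alpha L * (super_deriv b a f L * g L))
     = (\<Sum>L\<in>seqs n m N. (-1) ^ alpha L *
         ((-1) ^ ((par a + par b) * (par a + psum L)) * f L * super_deriv a b g L))"
proof -
  let ?c = "par a + par b"
  let ?t = "\<lambda>k L. (-1 :: 'a) ^ alpha L * ((-1) ^ (?c * psum (take k L)) * f (L[k := a])) * g L"
  let ?u = "\<lambda>k L. (-1 :: 'a) ^ alpha L * ((-1) ^ (?c * (par a + psum L)) * f L *
      ((-1) ^ (?c * psum (take k L)) * g (L[k := b])))"
  have lenN: "length L = N" if "L \<in> seqs n m N" for L using that by (simp add: seqs_def)
  have upd: "L[k := c] \<in> seqs n m N" if "L \<in> seqs n m N" "c \<in> RV n m" for L k c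
    using that set_update_subset_insert[of L k c] by (auto simp: seqs_def)
  have "(\<Sum>L\<in>seqs n m N. (-1) ^ alpha L * (super_deriv b a f L * g L))
      = (\<Sum>L\<in>seqs n m N. \<Sum>k<N. if L ! k = b then ?t k L else 0)"
    by (intro sum.cong refl)
      (auto simp: lenN super_deriv_def sum_distrib_left sum_distrib_right add.commute intro!: sum.cong)
  also have "\<dots> = (\<Sum>k<N. \<Sum>L\<in>{L\<in>seqs n m N. L ! k = b}. ?t k L)"
    by (subst sum.swap) (simp add: sum.inter_filter)
  also have "\<dots> = (\<Sum>k<N. \<Sum>L\<in>{L\<in>seqs n m N. L ! k = a}. ?u k L)"
  proof (rule sum.cong[OF refl])
    fix k assume "k \<in> {..<N}"
    then have k: "k < N" by simp
    show "(\<Sum>L\<in>{L\<in>seqs n m N. L ! k = b}. ?t k L) = (\<Sum>L\<in>{L\<in>seqs n m N. L ! k = a}. ?u k L)"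
    \<comment> \<open>The words with \<open>b\<close> at position \<open>k\<close> and those with
      \<open>a\<close> there correspond by replacing that one letter.\<close>
    proof (rule sum.reindex_bij_witness[of _ "\<lambda>L. L[k := b]" "\<lambda>L. L[k := a]"])
      fix L assume L: "L \<in> {L\<in>seqs n m N. L ! k = b}"
      then have len: "length L = N" and Lk: "L ! k = b" by (auto simp: lenN)
      show "L[k := a, k := b] = L" using Lk by (metis list_update_id list_update_overwrite)
      show "L[k := a] \<in> {L\<in>seqs n m N. L ! k = a}" using L k upd ab by (auto simp: lenN)
      have eq: "L[k := a, k := b] = L" by fact
      show "?u k (L[k := a]) = ?t k L"
        unfolding eq sign_alpha_update[of k L b a, OF k[folded len] Lk, where 'a = 'a] power_add
        by (simp add: mult_ac)
    next
      fix L assume L: "L \<in> {L\<in>seqs n m N. L ! k = a}"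
      then show "L[k := b, k := a] = L" by (metis (mono_tags, lifting) list_update_id list_update_overwrite mem_Collect_eq)
      show "L[k := b] \<in> {L\<in>seqs n m N. L ! k = b}" using L k upd ab by (auto simp: lenN)
    qed
  qed
  also have "\<dots> = (\<Sum>L\<in>seqs n m N. \<Sum>k<N. if L ! k = a then ?u k L else 0)"
    by (subst sum.swap) (simp add: sum.inter_filter)
  also have "\<dots> = (\<Sum>L\<in>seqs n m N. (-1) ^ alpha L *
         ((-1) ^ (?c * (par a + psum L)) * f L * super_deriv a b g L))"
    by (intro sum.cong refl)
      (auto simp: lenN super_deriv_def sum_distrib_left intro!: sum.cong)
  finally show ?thesis .
qed

section \<open>The tableaux and the outer factors\<close>

lemma I_h_Suc: "I_h n (Suc h) = map Ev [1..<n+1] @ I_h n h"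
  by (simp add: I_h_def)

lemma J_h_Suc: "J_h (Suc m) h = J_h m h @ replicate h (Od (Suc m))"
  by (simp add: J_h_def)

lemma length_I_h [simp]: "length (I_h n h) = n * h"
  by (induction h) (simp_all add: I_h_Suc, simp add: I_h_def)

lemma length_J_h [simp]: "length (J_h m h) = m * h"
  by (induction m) (simp_all add: J_h_Suc, simp add: J_h_def)

lemma nth_I_h: "k < n * h \<Longrightarrow> I_h n h ! k = Ev (Suc (k mod n))"
proof (induction h arbitrary: k)
  case (Suc h)
  show ?case
  proof (cases "k < n")
    case True
    then show ?thesis by (simp add: I_h_Suc nth_append del: upt_Suc)
  next
    case False
    then have "I_h n h ! (k - n) = Ev (Suc ((k - n) mod n))" using Suc.prems by (intro Suc.IH) simp
    then show ?thesis using False by (simp add: I_h_Suc nth_append le_mod_geq del: upt_Suc)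
  qed
qed simp

lemma nth_J_h: "k < m * h \<Longrightarrow> J_h m h ! k = Od (Suc (k div h))"
proof (induction m)
  case (Suc m)
  show ?case
  proof (cases "k < m * h")
    case True
    then show ?thesis using Suc.IH by (simp add: J_h_Suc nth_append)
  next
    case False
    then have "k div h = m" using Suc.prems by (intro div_nat_eqI) (simp_all add: mult.commute)
    then show ?thesis using False Suc.prems by (simp add: J_h_Suc nth_append)
  qed
qed simp

lemma count_list_I_h: "i \<in> {1..n} \<Longrightarrow> count_list (I_h n h) (Ev i) = h"
proof (induction h)
  case (Suc h)
  have "count_list (map Ev [1..<N+1]) (Ev i) = (if i \<in> {1..N} then 1 else 0)" for N
    by (induction N) auto
  then show ?case using Suc by (simp add: I_h_Suc del: upt_Suc)
qed (simp add: I_h_def)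

lemma count_list_J_h: "count_list (J_h m h) (Od j) = (if j \<in> {1..m} then h else 0)"
proof (induction m)
  case (Suc m)
  have "count_list (replicate h x) y = (if x = y then h else 0)" for x y :: idx
    by (induction h) auto
  then show ?case using Suc by (auto simp: J_h_Suc)
qed (simp add: J_h_def)

lemma psum_I_h: "psum (I_h n h) = 0"
  by (auto simp: psum_def I_h_def)

lemma psum_J_h: "psum (J_h m h) = m * h"
  by (induction m) (simp_all add: J_h_Suc psum_def sum_list_replicate, simp add: J_h_def)

lemma set_I_h: "set (I_h n h) \<subseteq> Ev ` {1..n}"
  by (auto simp: I_h_def)

lemma set_J_h: "set (J_h m h) \<subseteq> Od ` {1..m}"
  by (auto simp: J_h_def)

lemma super_deriv_notin: "a \<notin> set J \<Longrightarrow> super_deriv a b f J = 0"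
  unfolding super_deriv_def by (intro sum.neutral) auto

lemma super_deriv_diag: "super_deriv a a f J = of_nat (count_list J a) * f J"
proof -
  have "super_deriv a a f J = (\<Sum>k<length J. if J ! k = a then f J else 0)"
    unfolding super_deriv_def
    by (intro sum.cong refl) (auto simp: mult_2[symmetric] power_mult simp del: mult_2)
  also have "\<dots> = of_nat (card {k. k < length J \<and> J ! k = a}) * f J"
    by (simp add: sum.If_cases Int_def)
  also have "card {k. k < length J \<and> J ! k = a} = count_list J a"
    by (simp add: count_list_eq_length_filter length_filter_conv_card eq_commute)
  finally show ?thesis .
qed

text \<open>The numbering continues across the two blocks of \<open>s\<close>, so the whole tableau
  is filled column by column; rows and columns are remainders and quotients modulo
  \<open>n\<close>.\<close>

lemma tab_s_eq: "tab_s n m h i j = j * n + i"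
  by (simp add: tab_s_def diff_mult_distrib)

lemma tab_s_row:
  assumes "x < n * (h + m)" "i < n"
  shows "x \<in> {tab_s n m h i j | j. j < h + m} \<longleftrightarrow> x mod n = i"
proof
  assume "x mod n = i"
  then have "x = (x div n) * n + i" by (metis div_mult_mod_eq)
  moreover have "x div n < h + m" using assms by (simp add: less_mult_imp_div_less mult.commute)
  ultimately show "x \<in> {tab_s n m h i j | j. j < h + m}" unfolding tab_s_eq by blast
qed (use assms in \<open>auto simp: tab_s_eq\<close>)

lemma tab_s_col:
  assumes "n > 0"
  shows "x \<in> {tab_s n m h i j | i. i < n} \<longleftrightarrow> x div n = j"
proof
  assume "x div n = j"
  then have "x = j * n + x mod n" by (metis div_mult_mod_eq)
  moreover have "x mod n < n" using assms by simp
  ultimately show "x \<in> {tab_s n m h i j | i. i < n}" unfolding tab_s_eq by blast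
qed (use assms in \<open>auto simp: tab_s_eq\<close>)

definition t_col :: "nat \<Rightarrow> nat \<Rightarrow> nat \<Rightarrow> nat \<Rightarrow> nat" where
  "t_col n m h x = (if x < n * m then x div n else (x - n * m) div h)"

lemma t_col_less:
  assumes "x < (n + h) * m"
  shows "t_col n m h x < m"
  using assms by (auto simp: t_col_def less_mult_imp_div_less mult.commute algebra_simps)

lemma row_col_less: "i < n \<Longrightarrow> j < m \<Longrightarrow> j * n + i < n * (m :: nat)"
  by (metis mult.commute mult_Suc add.commute less_le_trans add_less_cancel_left mult_le_mono1 Suc_leI)

lemma tab_t_col:
  assumes "x < (n + h) * m" "j < m"
  shows "x \<in> {tab_t n m h i j | i. i < n + h} \<longleftrightarrow> t_col n m h x = j"
proof
  assume "x \<in> {tab_t n m h i j | i. i < n + h}"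
  then obtain i where i: "x = tab_t n m h i j" "i < n + h" by blast
  show "t_col n m h x = j"
  proof (cases "i < n")
    case True
    then show ?thesis using i assms row_col_less[of i n j m] by (simp add: tab_t_def t_col_def)
  next
    case False
    then obtain l where "i = n + l" by (metis le_Suc_ex linorder_not_less)
    then show ?thesis using i by (simp add: tab_t_def t_col_def)
  qed
next
  assume c: "t_col n m h x = j"
  show "x \<in> {tab_t n m h i j | i. i < n + h}"
  proof (cases "x < n * m")
    case True
    then have "n > 0" by (cases n) auto
    have "x = tab_t n m h (x mod n) j" using True c \<open>n > 0\<close>
      by (simp add: tab_t_def t_col_def) (metis div_mult_mod_eq)
    moreover have "x mod n < n + h" using \<open>n > 0\<close> by (simp add: trans_less_add1)
    ultimately show ?thesis by blast
  next
    case False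
    then have "h > 0" using assms by (cases h) auto
    define y where "y = x - n * m"
    have "j * h + y mod h = y" using False c by (metis div_mult_mod_eq t_col_def y_def)
    moreover have "x = n * m + y" using False by (simp add: y_def)
    ultimately have "x = tab_t n m h (n + y mod h) j" by (simp add: tab_t_def)
    moreover have "n + y mod h < n + h" using \<open>h > 0\<close> by simp
    ultimately show ?thesis by blast
  qed
qed

text \<open>Only the lower block is treated: its entries are the positions \<open>n * m + k\<close>
  occupied by \<open>J_h\<close>.\<close>

lemma tab_t_row:
  assumes "k < m * h" "i < n + h"
  shows "n * m + k \<in> {tab_t n m h i j | j. j < m} \<longleftrightarrow> i = n + k mod h"
proof
  assume "n * m + k \<in> {tab_t n m h i j | j. j < m}"
  then obtain j where j: "n * m + k = tab_t n m h i j" "j < m" by blast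
  show "i = n + k mod h"
  proof (cases "i < n")
    case True
    then show ?thesis using j row_col_less[of i n j m] by (simp add: tab_t_def)
  next
    case False
    then obtain l where "i = n + l" by (metis le_Suc_ex linorder_not_less)
    then show ?thesis using j assms by (simp add: tab_t_def)
  qed
next
  assume i: "i = n + k mod h"
  have "k div h < m" using assms by (simp add: less_mult_imp_div_less)
  moreover have "n * m + k = tab_t n m h i (k div h)" by (simp add: i tab_t_def)
  ultimately show "n * m + k \<in> {tab_t n m h i j | j. j < m}" by blast
qed

lemma transpose_row_s:
  assumes "x < n * (h + m)" "y < n * (h + m)" "x mod n = y mod n"
  shows "transpose x y \<in> rowgrp (tab_s n m h) n (h + m)"
  by (rule transpose_in_rowgrp) (use assms in \<open>simp_all only: tab_s_row\<close>)

lemma transpose_col_s: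
  assumes "x < n * (h + m)" "y < n * (h + m)" "x div n = y div n"
  shows "transpose x y \<in> colgrp (tab_s n m h) n (h + m)"
proof -
  have "n > 0" using assms by (cases n) auto
  show ?thesis by (rule transpose_in_colgrp) (use assms in \<open>simp_all only: tab_s_col[OF \<open>n > 0\<close>]\<close>)
qed

lemma transpose_col_t:
  assumes "x < (n + h) * m" "y < (n + h) * m" "t_col n m h x = t_col n m h y"
  shows "transpose x y \<in> colgrp (tab_t n m h) (n + h) m"
  by (rule transpose_in_colgrp) (use assms in \<open>simp_all only: tab_t_col\<close>)

lemma transpose_row_t:
  assumes "k < m * h" "l < m * h" "k mod h = l mod h"
  shows "transpose (n * m + k) (n * m + l) \<in> rowgrp (tab_t n m h) (n + h) m"
  by (rule transpose_in_rowgrp) (use assms in \<open>simp_all only: tab_t_row, simp_all add: algebra_simps\<close>)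

lemma young_e_length:
  assumes "length J \<noteq> length P"
  shows "young_e T r c (basis_v P) J = (0 :: 'a::field)" "young_e' T r c (basis_v P) J = (0 :: 'a)"
proof -
  have "permact \<sigma> (permact \<tau> (basis_v P)) J = (0 :: 'a)" for \<sigma> \<tau>
    using assms by (auto simp: permact_def Let_def basis_v_def)
  then show "young_e T r c (basis_v P) J = (0 :: 'a)" "young_e' T r c (basis_v P) J = (0 :: 'a)"
    by (simp_all add: young_e_def young_e'_def)
qed

text \<open>Some summand \<open>L\<close> contributes, and the symmetrizers only rearrange letters.
  The letters of \<open>I_h\<close> are even and all \<open>m * h\<close> letters of
  \<open>J_h\<close> are odd, which gives the relation between the parities.\<close>

lemma the_element_support:
  assumes "the_element n m h I K \<noteq> (0 :: 'a::field)"
  shows "length I = n * (h + m)" "length K = (n + h) * m" "set I \<subseteq> RV n m" "set K \<subseteq> RV n m"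
    "psum K = psum I + m * h"
proof -
  have "\<exists>L\<in>seqs n m (n * m). young_e (tab_s n m h) n (h + m) (basis_v (I_h n h @ L)) I \<noteq> (0 :: 'a)
      \<and> young_e' (tab_t n m h) (n + h) m (basis_v (L @ J_h m h)) K \<noteq> (0 :: 'a)"
  proof (rule ccontr)
    assume "\<not> ?thesis"
    then have "the_element n m h I K = (0 :: 'a)"
      unfolding the_element_def by (intro sum.neutral) auto
    then show False using assms by simp
  qed
  then obtain L where L: "length L = n * m" "set L \<subseteq> RV n m"
    and S: "young_e (tab_s n m h) n (h + m) (basis_v (I_h n h @ L)) I \<noteq> (0 :: 'a)"
    and T: "young_e' (tab_t n m h) (n + h) m (basis_v (L @ J_h m h)) K \<noteq> (0 :: 'a)"
    by (auto simp: seqs_def)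
  show I: "length I = n * (h + m)" using young_e_length(1)[of I "I_h n h @ L"] S L by (metis length_append length_I_h distrib_left)
  show K: "length K = (n + h) * m" using young_e_length(2)[of K "L @ J_h m h"] T L by (metis length_append length_J_h distrib_right mult.commute)
  have mI: "mset I = mset (I_h n h @ L)" using young_e_support[OF S I] .
  have mK: "mset K = mset (L @ J_h m h)" using young_e'_support[OF T K] .
  show "set I \<subseteq> RV n m" using mset_eq_setD[OF mI] set_I_h[of n h] L by (auto simp: RV_def)
  show "set K \<subseteq> RV n m" using mset_eq_setD[OF mK] set_J_h[of m h] L by (auto simp: RV_def)
  have "psum I = psum L" using psum_mset[OF mI] psum_I_h[of n h] by (simp add: psum_def)
  moreover have "psum K = psum L + m * h" using psum_mset[OF mK] psum_J_h[of m h] by (simp add: psum_def)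
  ultimately show "psum K = psum I + m * h" by simp
qed

section \<open>Invariance of the element\<close>

text \<open>The coefficients of \<open>v\<^sub>I\<close> in \<open>e\<^sub>s v\<^sub>P\<close> and of \<open>v\<^sup>*\<^sub>K\<close> in \<open>e\<^sub>t v\<^sup>*\<^sub>Q\<close> (the latter with the
  symmetrizer \<open>\<tau>\<sigma>\<close> of the paper's tilde).\<close>

abbreviation es :: "nat \<Rightarrow> nat \<Rightarrow> nat \<Rightarrow> idx list \<Rightarrow> idx list \<Rightarrow> 'a::field" where
  "es n m h I P \<equiv> young_e (tab_s n m h) n (h + m) (basis_v P) I"

abbreviation et :: "nat \<Rightarrow> nat \<Rightarrow> nat \<Rightarrow> idx list \<Rightarrow> idx list \<Rightarrow> 'a::field" where
  "et n m h K Q \<equiv> young_e' (tab_t n m h) (n + h) m (basis_v Q) K"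

text \<open>Since \<open>\<theta>\<close> is invariant and the symmetrizers commute with the action, the generators of
  \<open>gl(V)\<close> act only on the outer factors \<open>v\<^bsub>I\<^sub>h\<^esub>\<close> and \<open>v\<^sup>*\<^bsub>J\<^sub>h\<^esub>\<close>.\<close>

lemma gl_op_the_element:
  fixes I K :: "idx list"
  assumes ab: "a \<in> RV n m" "b \<in> RV n m" and I: "length I = n * (h + m)" and K: "length K = (n + h) * m"
  shows "gl_op a b (the_element n m h) I K = (\<Sum>L\<in>seqs n m (n * m). (-1 :: 'a::field) ^ alpha L *
     (super_deriv b a (\<lambda>A. es n m h I (A @ L)) (I_h n h) * et n m h K (L @ J_h m h)
      - (-1) ^ ((par a + par b) * par a) * es n m h I (I_h n h @ L)
         * super_deriv a b (\<lambda>B. et n m h K (L @ B)) (J_h m h)))"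
proof -
  let ?c = "par a + par b" and ?I = "I_h n h" and ?J = "J_h m h"
  let ?S = "\<lambda>P. es n m h I P :: 'a" and ?T = "\<lambda>Q. et n m h K Q :: 'a"
  let ?s = "\<lambda>L. (-1 :: 'a) ^ alpha L"
  have 1: "super_deriv a b (\<lambda>I. the_element n m h I K) I
      = (\<Sum>L\<in>seqs n m (n * m). ?s L * (super_deriv b a ?S (?I @ L) * ?T (L @ ?J)))"
    unfolding the_element_def super_deriv_sum super_deriv_scale_right super_deriv_scale
      super_deriv_young_e_basis[OF I] mult.assoc ..
  have 2: "super_deriv b a (the_element n m h I) K
      = (\<Sum>L\<in>seqs n m (n * m). ?s L * (?S (?I @ L) * super_deriv a b ?T (L @ ?J)))"
    unfolding the_element_def super_deriv_sum super_deriv_scale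
      super_deriv_young_e'_basis[OF K] mult.assoc ..
  \<comment> \<open>This trades the global sign in \<open>psum I\<close> for one in
    \<open>psum L\<close>, the form needed by \<open>theta_invariant\<close>.\<close>
  have ps: "?S (?I @ L) = 0 \<or> psum I = psum L" for L
  proof (cases "?S (?I @ L) = 0")
    case False
    from psum_mset[OF young_e_support[OF False I]] show ?thesis
      using psum_I_h[of n h] by (simp add: psum_def)
  qed simp
  have 3: "(-1) ^ (?c * (par a + psum I)) * (?s L * (?S (?I @ L) * super_deriv a b ?T (L @ ?J)))
      = ?s L * ((-1) ^ (?c * (par a + psum L)) * ?S (?I @ L) * super_deriv a b (\<lambda>A. ?T (A @ ?J)) L)
       + ?s L * ((-1) ^ (?c * par a) * ?S (?I @ L) * super_deriv a b (\<lambda>B. ?T (L @ B)) ?J)" for L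
  proof (cases "?S (?I @ L) = 0")
    case False
    then have p: "psum I = psum L" using ps by blast
    have "(-1) ^ (?c * (par a + psum L)) * (-1) ^ (?c * psum L) = (-1 :: 'a) ^ (?c * par a)"
      unfolding distrib_left power_add mult.assoc sign_power_sq by simp
    then have "(-1) ^ (?c * (par a + psum L)) * ((-1) ^ (?c * psum L) * z) = (-1) ^ (?c * par a) * (z :: 'a)" for z
      by (simp add: mult.assoc[symmetric])
    then show ?thesis unfolding super_deriv_append p by (simp add: ring_distribs(1) mult.left_commute mult.assoc)
  qed simp
  have 4: "super_deriv b a ?S (?I @ L) = super_deriv b a (\<lambda>A. ?S (A @ L)) ?I + super_deriv b a (\<lambda>B. ?S (?I @ B)) L" for L
    unfolding super_deriv_append psum_I_h by simp
  have 5: "?s L * (super_deriv b a ?S (?I @ L) * ?T (L @ ?J))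
     = ?s L * (super_deriv b a (\<lambda>A. ?S (A @ L)) ?I * ?T (L @ ?J))
       + ?s L * (super_deriv b a (\<lambda>B. ?S (?I @ B)) L * ?T (L @ ?J))" for L
    unfolding 4 by (simp only: distrib_left distrib_right)
  \<comment> \<open>The parts acting on \<open>L\<close> in the two factors cancel by
    \<open>theta_invariant\<close>; only the parts on \<open>I_h\<close> and \<open>J_h\<close>
    remain.\<close>
  show ?thesis
    unfolding gl_op_def 1 2 sum_distrib_left[of "(-1) ^ (?c * (par a + psum I))"] 3 5 sum.distrib
      theta_invariant[OF ab] right_diff_distrib sum_subtractf
    by simp
qed

text \<open>Each of the first \<open>h\<close> columns of \<open>s\<close> carries all even letters
  once. The changed letter duplicates the \<open>Ev i\<close> already in its column, at the position
  \<open>y\<close>.\<close>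

lemma I_h_update_vanish:
  assumes I: "length I = n * (h + m)" and L: "length L = n * m"
    and k: "k < n * h" and i: "I_h n h ! k \<noteq> Ev i" "i \<in> {1..n}"
  shows "es n m h I ((I_h n h)[k := Ev i] @ L) = (0 :: 'a::field_char_0)"
proof -
  have n: "n > 0" using k by (cases n) auto
  obtain i0 where i0: "i = Suc i0" using i by (cases i) auto
  define y where "y = (k div n) * n + i0"
  have "k div n < h" using k by (simp add: less_mult_imp_div_less mult.commute)
  then have y: "y < n * h" "y mod n = i0" "y div n = k div n"
    using i n row_col_less[of i0 n "k div n" h] by (auto simp: y_def i0)
  have Iy: "I_h n h ! y = Ev i" using y i0 by (simp add: nth_I_h)
  have ky: "k \<noteq> y" using Iy i by auto
  have lt: "k < n * (h + m)" "y < n * (h + m)" using k y by (simp_all add: distrib_left)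
  show ?thesis
  proof (rule young_e_basis_vanish[where x = k and y = y and i = i])
    show "transpose k y \<in> colgrp (tab_s n m h) n (h + m)"
      by (rule transpose_col_s) (use lt y in auto)
  qed (use I L k y ky Iy lt in \<open>auto simp: nth_append distrib_left\<close>)
qed

text \<open>Each lower row of \<open>t\<close> carries all odd letters once. The changed letter
  duplicates the \<open>Od j\<close> in its row, found in column \<open>j - 1\<close> since columns
  count from 0.\<close>

lemma J_h_update_vanish:
  assumes K: "length K = (n + h) * m" and L: "length L = n * m"
    and k: "k < m * h" and j: "J_h m h ! k \<noteq> Od j" "j \<in> {1..m}"
  shows "et n m h K (L @ (J_h m h)[k := Od j]) = (0 :: 'a::field_char_0)"
proof -
  have h: "h > 0" using k by (cases h) auto
  define y where "y = (j - 1) * h + k mod h"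
  have y: "y < m * h" "y mod h = k mod h" "y div h = j - 1"
    using j h row_col_less[of "k mod h" h "j - 1" m] by (auto simp: y_def mult.commute[of m])
  have Jy: "J_h m h ! y = Od j" using y j by (simp add: nth_J_h)
  have ky: "k \<noteq> y" using Jy j by auto
  have le: "n * m + z < (n + h) * m" if "z < m * h" for z using that by (simp add: algebra_simps)
  show ?thesis
  proof (rule young_e'_basis_vanish[where x = "n * m + k" and y = "n * m + y" and i = j])
    show "transpose (n * m + k) (n * m + y) \<in> rowgrp (tab_t n m h) (n + h) m"
      by (rule transpose_row_t) (use k y in auto)
  qed (use K L k y ky Jy le in \<open>auto simp: nth_append algebra_simps\<close>)
qed

context
  fixes n m h :: nat and I K :: "idx list"
  assumes I: "length I = n * (h + m)" and K: "length K = (n + h) * m"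
begin

lemma gl_op_Ev_Od:
  assumes "i \<in> {1..n}" "j \<in> {1..m}"
  shows "gl_op (Ev i) (Od j) (the_element n m h) I K = (0 :: 'a::field)"
proof -
  have "Od j \<notin> set (I_h n h)" "Ev i \<notin> set (J_h m h)"
    using set_I_h[of n h] set_J_h[of m h] by auto
  then show ?thesis
    using assms by (simp add: gl_op_the_element[OF _ _ I K] RV_def super_deriv_notin)
qed

text \<open>Only \<open>I_h\<close> is affected, as \<open>J_h\<close> has no even letter. On the
  diagonal the \<open>h\<close> copies of \<open>Ev i\<close> are counted; off the diagonal a column
  of \<open>s\<close> gets a repetition.\<close>

lemma gl_op_Ev_Ev:
  assumes i: "i \<in> {1..n}" "i' \<in> {1..n}"
  shows "gl_op (Ev i) (Ev i') (the_element n m h) I K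
     = (if i = i' then of_nat h * the_element n m h I K else (0 :: 'a::field_char_0))"
proof -
  have nJ: "Ev i \<notin> set (J_h m h)" using set_J_h[of m h] by auto
  have *: "gl_op (Ev i) (Ev i') (the_element n m h) I K = (\<Sum>L\<in>seqs n m (n * m). (-1 :: 'a) ^ alpha L *
      (super_deriv (Ev i') (Ev i) (\<lambda>A. es n m h I (A @ L)) (I_h n h) * et n m h K (L @ J_h m h)))"
    using i by (simp add: gl_op_the_element[OF _ _ I K] RV_def super_deriv_notin[OF nJ])
  show ?thesis
  proof (cases "i = i'")
    case True
    then show ?thesis unfolding *
      using i by (simp add: super_deriv_diag count_list_I_h the_element_def sum_distrib_left mult_ac)
  next
    case False
    have "super_deriv (Ev i') (Ev i) (\<lambda>A. es n m h I (A @ L)) (I_h n h) = (0 :: 'a)"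
      if "L \<in> seqs n m (n * m)" for L
      unfolding super_deriv_def
      by (intro sum.neutral) (use that i False I_h_update_vanish[OF I, where 'a = 'a] in \<open>auto simp: seqs_def\<close>)
    then show ?thesis unfolding * using False by simp
  qed
qed

text \<open>Only \<open>J_h\<close> is affected, and the contragredient action gives the minus sign;
  off the diagonal a row of \<open>t\<close> gets a repetition.\<close>

lemma gl_op_Od_Od:
  assumes j: "j \<in> {1..m}" "j' \<in> {1..m}"
  shows "gl_op (Od j) (Od j') (the_element n m h) I K
     = (if j = j' then - (of_nat h * the_element n m h I K) else (0 :: 'a::field_char_0))"
proof -
  have nI: "Od j' \<notin> set (I_h n h)" using set_I_h[of n h] by auto
  have *: "gl_op (Od j) (Od j') (the_element n m h) I K = (\<Sum>L\<in>seqs n m (n * m). (-1 :: 'a) ^ alpha L *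
      (- (es n m h I (I_h n h @ L) * super_deriv (Od j) (Od j') (\<lambda>B. et n m h K (L @ B)) (J_h m h))))"
    using j by (simp add: gl_op_the_element[OF _ _ I K] RV_def super_deriv_notin[OF nI])
  show ?thesis
  proof (cases "j = j'")
    case True
    then show ?thesis unfolding *
      using j by (simp add: super_deriv_diag count_list_J_h the_element_def sum_distrib_left sum_negf mult_ac)
  next
    case False
    have "super_deriv (Od j) (Od j') (\<lambda>B. et n m h K (L @ B)) (J_h m h) = (0 :: 'a)"
      if "L \<in> seqs n m (n * m)" for L
      unfolding super_deriv_def
      by (intro sum.neutral) (use that j False J_h_update_vanish[OF K, where 'a = 'a] in \<open>auto simp: seqs_def\<close>)
    then show ?thesis unfolding * using False by simp
  qed
qed

end

section \<open>Vanishing of the remaining odd generators\<close>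

lemma the_element_row_symmetric:
  assumes "length I = n * (h + m)" "x < n * (h + m)" "y < n * (h + m)" "x mod n = y mod n"
  shows "permact (transpose x y) (\<lambda>I. the_element n m h I K) I = (the_element n m h I K :: 'a::field)"
  unfolding the_element_def permact_sum permact_scale_right permact_scale
  using young_e_row_symmetric[OF assms(1) transpose_row_s[OF assms(2-4)], where 'a = 'a] by simp

lemma the_element_col_antisymmetric:
  assumes "length K = (n + h) * m" "x < (n + h) * m" "y < (n + h) * m"
    "t_col n m h x = t_col n m h y" "x \<noteq> y"
  shows "permact (transpose x y) (the_element n m h I) K = - (the_element n m h I K :: 'a::field)"
  unfolding the_element_def[abs_def] permact_sum permact_scale
  using young_e'_col_antisymmetric[OF assms(1) transpose_col_t[OF assms(2-4)] assms(5), where 'a = 'a]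
  by (simp add: sum_negf)

lemma psum_card_odds: "psum K = card (odds K)"
proof (induction K rule: rev_induct)
  case (snoc x K)
  have "odds (K @ [x]) = (if par x = 1 then insert (length K) (odds K) else odds K)"
    by (auto simp: odds_def nth_append less_Suc_eq split: if_splits)
  moreover have "length K \<notin> odds K" by (simp add: odds_def)
  ultimately show ?case using snoc par_cases[of x] by (auto simp: psum_def)
qed (simp add: psum_def odds_def)

text \<open>The pigeonhole principle: with one odd letter fewer than \<open>m * h\<close>, the even
  positions outnumber the pairs of a column and an even letter.\<close>

lemma col_antisymmetric_vanish:
  fixes f :: "idx list \<Rightarrow> 'a::field_char_0"
  assumes K: "length K = (n + h) * m" "set K \<subseteq> RV n m" and ps: "psum K + 1 = m * h"
    and anti: "\<And>x y. x < (n + h) * m \<Longrightarrow> y < (n + h) * m \<Longrightarrow> t_col n m h x = t_col n m h y \<Longrightarrow> x \<noteq> y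
       \<Longrightarrow> permact (transpose x y) f K = - f K"
  shows "f K = 0"
proof -
  let ?q = "(n + h) * m"
  define E where "E = {..<?q} - odds K"
  have sub: "odds K \<subseteq> {..<?q}" using K by (auto simp: odds_def)
  have "card E = ?q - psum K" unfolding E_def psum_card_odds using sub by (simp add: card_Diff_subset)
  also have "\<dots> > m * n" using ps by (simp add: algebra_simps)
  finally have cE: "card E > m * n" .
  define \<phi> where "\<phi> k = (t_col n m h k, K ! k)" for k
  have ev: "K ! k \<in> Ev ` {1..n}" if "k \<in> E" for k
  proof -
    have "k < length K" "par (K ! k) \<noteq> 1" using that K by (auto simp: E_def odds_def)
    moreover then have "K ! k \<in> RV n m" using K(2) nth_mem by blast
    ultimately show ?thesis by (auto simp: RV_def)
  qed
  have "\<phi> ` E \<subseteq> {..<m} \<times> Ev ` {1..n}"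
    using ev t_col_less by (auto simp: \<phi>_def E_def)
  then have "card (\<phi> ` E) \<le> card ({..<m} \<times> Ev ` {1..n})" by (intro card_mono) auto
  also have "\<dots> = m * n" by (simp add: card_cartesian_product card_image inj_on_def)
  finally have "\<not> inj_on \<phi> E" using cE card_image by fastforce
  then obtain x y where xy: "x \<in> E" "y \<in> E" "x \<noteq> y" "\<phi> x = \<phi> y" by (auto simp: inj_on_def)
  have lt: "x < ?q" "y < ?q" using xy by (auto simp: E_def)
  have Kxy: "K ! x = K ! y" and col: "t_col n m h x = t_col n m h y" using xy by (auto simp: \<phi>_def)
  have \<pi>: "transpose x y permutes {..<length K}" using lt K by (intro permutes_swap_id) auto
  have "permute_list (transpose x y) K = K"
    using permute_list_transpose_eq[of x K y K] lt K Kxy by simp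
  \<comment> \<open>The repeated letter is even, so the exchange is free of sign, which contradicts
    antisymmetry unless the value is 0.\<close>
  moreover have "koszul (odds K) (transpose x y) = (1 :: 'a)"
    by (rule koszul_fixed) (use xy in \<open>auto simp: E_def transpose_def\<close>)
  ultimately have "permact (transpose x y) f K = f K" by (simp add: permact_koszul[OF \<pi>])
  then show ?thesis using anti[OF lt col xy(3)] by simp
qed

lemma gl_op_Od_Ev:
  assumes i: "i \<in> {1..n}" and j: "j \<in> {1..m}"
    and I: "length I = n * (h + m)" and K: "length K = (n + h) * m"
  shows "gl_op (Od j) (Ev i) (the_element n m h) I K = (0 :: 'a::field_char_0)"
proof -
  let ?X = "the_element n m h :: idx list \<Rightarrow> idx list \<Rightarrow> 'a"
  let ?Y = "gl_op (Od j) (Ev i) ?X"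
  have RV: "Od j \<in> RV n m" "Ev i \<in> RV n m" using i j by (auto simp: RV_def)
  \<comment> \<open>A nonzero coefficient comes from one of \<open>?X\<close> by changing one
    letter: either \<open>I\<close> gains an odd letter or \<open>K\<close> loses one.\<close>
  have supp: "set I \<subseteq> RV n m \<and> set K \<subseteq> RV n m \<and> psum K + 1 = psum I + m * h"
    if Y: "?Y I K \<noteq> 0" for I K
  proof -
    consider "super_deriv (Od j) (Ev i) (\<lambda>I. ?X I K) I \<noteq> 0" | "super_deriv (Ev i) (Od j) (?X I) K \<noteq> 0"
      using Y unfolding gl_op_def by force
    then show ?thesis
    proof cases
      case 1
      then obtain k where k: "k < length I" "I ! k = Od j" "?X (I[k := Ev i]) K \<noteq> 0"
        by (rule super_deriv_nonzero)
      note s = the_element_support[OF k(3)]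
      have "I = (I[k := Ev i])[k := Od j]" using k by (metis list_update_id list_update_overwrite)
      then have "set I \<subseteq> insert (Od j) (set (I[k := Ev i]))" by (metis set_update_subset_insert)
      then have "set I \<subseteq> RV n m" using s(3) RV by blast
      moreover have "psum I = psum (I[k := Ev i]) + 1" using psum_update[of k I "Ev i"] k by simp
      ultimately show ?thesis using s by simp
    next
      case 2
      then obtain k where k: "k < length K" "K ! k = Ev i" "?X I (K[k := Od j]) \<noteq> 0"
        by (rule super_deriv_nonzero)
      note s = the_element_support[OF k(3)]
      have "K = (K[k := Od j])[k := Ev i]" using k by (metis list_update_id list_update_overwrite)
      then have "set K \<subseteq> insert (Ev i) (set (K[k := Od j]))" by (metis set_update_subset_insert)
      then have "set K \<subseteq> RV n m" using s(4) RV by blast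
      moreover have "psum K + 1 = psum (K[k := Od j])" using psum_update[of k K "Od j"] k by simp
      ultimately show ?thesis using s by simp
    qed
  qed
  show ?thesis
  proof (rule lowering_vanish[where Y = ?Y and p = "n * (h + m)" and q = "(n + h) * m" and n = n and m = m])
    fix I K :: "idx list" and x y
    assume l: "length I = n * (h + m)" "length K = (n + h) * m"
      and xy: "x < n * (h + m)" "y < n * (h + m)" "x mod n = y mod n"
    show "permact (transpose x y) (\<lambda>I. ?Y I K) I = ?Y I K"
    proof (rule gl_op_permact_left)
      show "transpose x y permutes {..<length I}" using l xy by (intro permutes_swap_id) auto
    qed (use the_element_row_symmetric[OF _ xy] l in auto)
  next
    fix I K :: "idx list"
    assume l: "length I = n * (h + m)" "length K = (n + h) * m" and "psum I = 0"
    show "?Y I K = 0"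
    proof (rule ccontr)
      assume Y: "?Y I K \<noteq> 0"
      have "?Y I K = 0"
      proof (rule col_antisymmetric_vanish)
        show "length K = (n + h) * m" by fact
        show "set K \<subseteq> RV n m" "psum K + 1 = m * h" using supp[OF Y] \<open>psum I = 0\<close> by auto
        fix x y assume xy: "x < (n + h) * m" "y < (n + h) * m" "t_col n m h x = t_col n m h y" "x \<noteq> y"
        show "permact (transpose x y) (?Y I) K = - ?Y I K"
        proof (rule gl_op_permact_right)
          show "transpose x y permutes {..<length K}" using l xy by (intro permutes_swap_id) auto
        qed (use the_element_col_antisymmetric[OF _ xy] l in auto)
      qed
      then show False using Y by simp
    qed
  next
    fix I K :: "idx list" and r j'
    assume l: "length I = n * (h + m)" "length K = (n + h) * m" and r: "r \<in> {1..n}" and j': "j' \<in> {1..m}"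
    \<comment> \<open>The lowering operator kills \<open>?X\<close> at words of these lengths, and
      replacing letters preserves lengths. In the anticommutator only the case \<open>r = i\<close>,
      \<open>j = j'\<close> could contribute, and there the eigenvalues \<open>h\<close> and
      \<open>-h\<close> cancel.\<close>
    have "gl_op (Od j) (Ev i) (gl_op (Ev r) (Od j') ?X) I K = gl_op (Od j) (Ev i) (\<lambda>_ _. 0) I K"
      unfolding gl_op_def[of "Od j"]
      by (intro arg_cong2[where f = "(-)"] arg_cong2[where f = "(*)"] refl super_deriv_cong)
        (use gl_op_Ev_Od[OF _ _ r j'] l in auto)
    also have "\<dots> = 0" by (simp add: gl_op_def super_deriv_def cong: if_cong)
    finally show "gl_op (Ev r) (Od j') ?Y I K = 0"
      using gl_op_anticommutator[of r j' j i ?X I K] gl_op_Ev_Ev[OF l r i, where 'a = 'a]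
        gl_op_Od_Od[OF l j j', where 'a = 'a]
      by (auto split: if_splits)
  qed (use i I K supp in auto)
qed

lemma sum_RV: "sum f (RV n m) = (\<Sum>i\<in>{1..n}. f (Ev i)) + (\<Sum>j\<in>{1..m}. f (Od j))"
  unfolding RV_def by (subst sum.union_disjoint) (auto simp: sum.reindex inj_on_def)

theorem theorem3p4:
  fixes n m h :: nat
  shows "sl_invariant n m (n * (m + h)) (m * (n + h))
           (the_element n m h :: idx list \<Rightarrow> idx list \<Rightarrow> 'a::field_char_0)"
  unfolding sl_invariant_def
proof (intro allI impI ext)
  fix A :: "idx \<Rightarrow> idx \<Rightarrow> 'a" and I K :: "idx list"
  assume str: "supertrace n m A = 0"
  let ?X = "the_element n m h :: idx list \<Rightarrow> idx list \<Rightarrow> 'a"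
  have "gl_act n m (n * (m + h)) (m * (n + h)) A ?X I K
      = (\<Sum>a\<in>RV n m. \<Sum>b\<in>RV n m. A a b * gl_op a b ?X I K)"
  proof (rule gl_act_eq)
    fix I K assume "?X I K \<noteq> 0"
    from the_element_support[OF this]
    show "I \<in> seqs n m (n * (m + h)) \<and> K \<in> seqs n m (m * (n + h))"
      by (simp add: seqs_def add.commute mult.commute)
  qed
  also have "\<dots> = 0"
  proof (cases "length I = n * (h + m) \<and> length K = (n + h) * m")
    case True
    then have l: "length I = n * (h + m)" "length K = (n + h) * m" by auto
    \<comment> \<open>All off-diagonal generators vanish; the eigenvalues \<open>h\<close> on even
      and \<open>-h\<close> on odd diagonal generators assemble into the supertrace.\<close>
    have "(\<Sum>a\<in>RV n m. \<Sum>b\<in>RV n m. A a b * gl_op a b ?X I K)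
        = (\<Sum>i\<in>{1..n}. A (Ev i) (Ev i) * (of_nat h * ?X I K))
          + (\<Sum>j\<in>{1..m}. A (Od j) (Od j) * - (of_nat h * ?X I K))"
      unfolding sum_RV
      by (intro arg_cong2[where f = "(+)"] sum.cong refl)
        (simp_all add: gl_op_Ev_Ev[OF l] gl_op_Od_Od[OF l] gl_op_Ev_Od[OF l] gl_op_Od_Ev[OF _ _ l]
          if_distrib[of "(*) _"] sum.delta sum.delta' cong: if_cong)
    also have "\<dots> = supertrace n m A * (of_nat h * ?X I K)"
      by (simp add: supertrace_def sum_distrib_right sum_negf left_diff_distrib)
    finally show ?thesis using str by simp
  next
    case False
    \<comment> \<open>Coefficient functions are defined on words of all lengths; letter replacement
      preserves lengths, so nothing is produced outside the right ones.\<close>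
    have "gl_op a b ?X I K = 0" for a b
    proof (rule ccontr)
      assume "gl_op a b ?X I K \<noteq> 0"
      then consider "super_deriv a b (\<lambda>I. ?X I K) I \<noteq> 0" | "super_deriv b a (?X I) K \<noteq> 0"
        unfolding gl_op_def by force
      then show False
      proof cases
        case 1
        then obtain k where "?X (I[k := b]) K \<noteq> 0" by (rule super_deriv_nonzero)
        from the_element_support(1,2)[OF this] show False using False by simp
      next
        case 2
        then obtain k where "?X I (K[k := a]) \<noteq> 0" by (rule super_deriv_nonzero)
        from the_element_support(1,2)[OF this] show False using False by simp
      qed
    qed
    then show ?thesis by simp
  qed
  finally show "gl_act n m (n * (m + h)) (m * (n + h)) A ?X I K = 0" .
qed

end
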